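(* Let $f:\mathcal X\to\mathbb R^d$, let $(T_n)_{n\ge1}$ be a sequence of time functions, let $\mathrm{BM}$ be the Brownian mechanism associated with $f$ and $(T_n)_{n\ge1}$, and let $N$ be a stopping function. For neighbors $x\sim x'$, the privacy loss $\mathcal L^{\mathrm{BM}}_{1:N(x)}(x,x')$ between $\mathrm{BM}_{1:N(x)}(x)$ and $\mathrm{BM}_{1:N(x')}(x')$ is given almost surely by $$\mathcal L_{1:N(x)}^{\mathrm{BM}}(x,x')=\frac{\|f(x)-f(x')\|_2^2}{2T_{N(x)}(x)}+\frac{\|f(x)-f(x')\|_2}{T_{N(x)}(x)}\,W_{T_{N(x)}(x)},$$ where $(W_t)_{t\ge0}$ is a standard univariate Brownian motion. Moreover, if $f$ has $\ell_2$-sensitivity at most $\Delta_2$, i.e. $\sup_{y\sim y'}\|f(y)-f(y')\|_2\le\Delta_2$, then, with $a^+:=\max(0,a)$, almost surely $$\mathcal L_{1:N(x)}^{\mathrm{BM}}(x,x')\le\frac{\Delta_2^2}{2T_{N(x)}(x)}+\frac{\Delta_2}{T_{N(x)}(x)}\,W^+_{T_{N(x)}(x)}.$$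
   Context: $\mathcal X$ is a set of databases with an arbitrary neighboring relation $\sim$. Privacy loss: for a randomized algorithm $A$ on $\mathcal X$ with values in a measurable space and $x\sim x'$, let $p^x,p^{x'}$ be the densities of the laws of $A(x),A(x')$ with respect to a common reference measure (e.g. the sum of the two laws). The privacy loss between $A(x)$ and $A(x')$ is the random variable $\mathcal L(x,x')=\log\frac{p^x(A(x))}{p^{x'}(A(x))}$ (defined up to almost sure equality). Time functions: a sequence of (measurable) functions $T_n:(\mathbb R^d)^{n-1}\to\mathbb R_{>0}$, $n\ge1$ (so $T_1$ is a constant), with $T_{n+1}(\beta_1,\dots,\beta_n)\le T_n(\beta_1,\dots,\beta_{n-1})$ for all $n\ge1$ and all $\beta_1,\dots,\beta_n\in\mathbb R^d$. Brownian mechanism: let $(B_t)_{t\ge0}$ be a standard $d$-dimensional Brownian motion started at $0$. $\mathrm{BM}(x)=(\mathrm{BM}_n(x))_{n\ge1}$ with $\mathrm{BM}_n(x)=f(x)+B_{T_n(x)}$, where recursively $T_n(x):=T_n(\mathrm{BM}_1(x),\dots,\mathrm{BM}_{n-1}(x))$. Write $\mathrm{BM}_{1:n}(x)=(\mathrm{BM}_1(x),\dots,\mathrm{BM}_n(x))$. Stopping function: a function $N:(\mathbb R^d)^\infty\to\mathbb N=\{1,2,\dots\}$ such that for every $x\in\mathcal X$, $N(x):=N(\mathrm{BM}(x))$ is a stopping time with respect to the filtration $\mathcal F_n(x)=\sigma(\mathrm{BM}_i(x):i\le n)$, $n\ge1$. $\mathrm{BM}_{1:N(x)}(x)$ is regarded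 as a random element of the disjoint union $\bigsqcup_{n\ge1}(\mathbb R^d)^n$. The Brownian motion $W$ lives on the same probability space as $B$ and may depend on $x,x'$.
   Formalization: Added: the Borel sets of outputs BM_{1:n} deciding N≤n must be the same for all databases. If N(x) is only a stopping time for each x separately the claim fails: T_n=1/n, N=1 on sequences with limit f(x), else 2, gives infinite loss. *)

theory Defs
  imports "HOL-Probability.Probability"
begin

text \<open>
  All sequences are indexed by \<open>{1..}\<close> and all \<open>n\<close>-tuples by \<open>{1..n}\<close>; following the
  library's product measures they are extensional functions on their index set.
\<close>

subsection \<open>Privacy loss\<close>

definition ln_ennreal :: "ennreal \<Rightarrow> ereal" where
  "ln_ennreal r =
     (if r = 0 then - \<infinity> else if r = \<top> then \<infinity> else ereal (ln (enn2real r)))"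

text \<open>
  \<open>A\<close> and \<open>A'\<close> are random elements of \<open>S\<close> (the outputs on two neighboring databases), and
  \<open>p\<close>, \<open>p'\<close> are densities of their laws with respect to a common reference measure \<open>\<mu>\<close>.
  The privacy loss is only determined up to almost sure equality, hence a predicate.
  It is extended-real valued, so that it is infinite where \<open>p'\<close> vanishes and \<open>p\<close> does not.
\<close>

definition is_privacy_loss ::
    "'a measure \<Rightarrow> 'b measure \<Rightarrow> ('a \<Rightarrow> 'b) \<Rightarrow> ('a \<Rightarrow> 'b) \<Rightarrow> ('a \<Rightarrow> ereal) \<Rightarrow> bool" where
  "is_privacy_loss M S A A' L \<longleftrightarrow>
     (\<exists>\<mu> p p'. sets \<mu> = sets S \<and> p \<in> borel_measurable \<mu> \<and> p' \<in> borel_measurable \<mu> \<and>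
        distr M S A = density \<mu> p \<and> distr M S A' = density \<mu> p' \<and>
        (AE \<omega> in M. L \<omega> = ln_ennreal (p (A \<omega>) / p' (A \<omega>))))"

lemma is_privacy_loss_exists:
  assumes "prob_space M"
  shows "\<exists>L. is_privacy_loss M S A A' L"
proof -
  interpret M: prob_space M by fact
  have fin: "finite_measure (distr M S X)" for X
  proof
    have "emeasure (distr M S X) (space (distr M S X)) \<le> emeasure M (space M)"
      unfolding distr_def emeasure_measure_of_conv
      by (auto simp del: M.emeasure_space_1 intro!: emeasure_mono)
    then show "emeasure (distr M S X) (space (distr M S X)) \<noteq> \<infinity>"
      by (auto simp: M.emeasure_space_1 top_unique)
  qed
  define P Q where "P = distr M S A" and "Q = distr M S A'"
  define \<mu> where "\<mu> = measure_of (space S) (sets S) (\<lambda>X. emeasure P X + emeasure Q X)"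
  have [simp]: "sets P = sets S" "sets Q = sets S" "space P = space S" "space Q = space S"
    by (simp_all add: P_def Q_def)
  have [simp]: "sets \<mu> = sets S" "space \<mu> = space S"
    by (simp_all add: \<mu>_def)
  have ca: "countably_additive (sets S) (\<lambda>X. emeasure P X + emeasure Q X)"
  proof (rule countably_additiveI)
    fix F :: "nat \<Rightarrow> 'b set"
    assume F: "range F \<subseteq> sets S" "disjoint_family F" "(\<Union>i. F i) \<in> sets S"
    show "(\<Sum>i. emeasure P (F i) + emeasure Q (F i)) =
        emeasure P (\<Union>i. F i) + emeasure Q (\<Union>i. F i)"
      using F by (simp add: suminf_add[symmetric] suminf_emeasure)
  qed
  have em: "emeasure \<mu> X = emeasure P X + emeasure Q X" if "X \<in> sets S" for X
    using that ca
    unfolding \<mu>_def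
    by (subst emeasure_measure_of_sigma)
      (auto simp: sets.sigma_algebra_axioms positive_def)
  interpret P: finite_measure P using fin by (simp add: P_def)
  interpret Q: finite_measure Q using fin by (simp add: Q_def)
  interpret mu: finite_measure \<mu>
    by standard
      (simp add: em[OF sets.top] P.emeasure_finite Q.emeasure_finite)
  have "absolutely_continuous \<mu> P" "absolutely_continuous \<mu> Q"
    by (auto simp: absolutely_continuous_def null_sets_def em)
  then obtain p p' where "p \<in> borel_measurable \<mu>" "density \<mu> p = P"
    and "p' \<in> borel_measurable \<mu>" "density \<mu> p' = Q"
    using mu.Radon_Nikodym[of P] mu.Radon_Nikodym[of Q] by auto
  then show ?thesis
    unfolding is_privacy_loss_def P_def Q_def
    by (intro exI[of _ "\<lambda>\<omega>. ln_ennreal (p (A \<omega>) / p' (A \<omega>))"] exI[of _ \<mu>] exI[of _ p]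
        exI[of _ p']) auto
qed

subsection \<open>Brownian motion\<close>

text \<open>
  Standard Brownian motion in a Euclidean space, indexed by times \<open>t \<ge> 0\<close>.  Start at \<open>0\<close> and
  continuity are required of every path, which makes the process jointly measurable, so that
  its value at a random time is a random variable.  The density is that of \<open>N(0, (t - s) I)\<close>;
  note that \<^term>\<open>normal_density\<close> takes the standard deviation.
\<close>

definition standard_brownian_motion ::
    "'a measure \<Rightarrow> (real \<Rightarrow> 'a \<Rightarrow> 'v::euclidean_space) \<Rightarrow> bool" where
  "standard_brownian_motion M B \<longleftrightarrow>
     prob_space M \<and>
     (\<forall>t\<ge>0. B t \<in> borel_measurable M) \<and>
     (\<forall>\<omega>\<in>space M. B 0 \<omega> = 0) \<and>
     (\<forall>\<omega>\<in>space M. continuous_on {0..} (\<lambda>t. B t \<omega>)) \<and>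
     (\<forall>(t::nat \<Rightarrow> real) n. 0 \<le> t 0 \<and> mono t \<longrightarrow>
        prob_space.indep_vars M (\<lambda>_. borel) (\<lambda>i \<omega>. B (t (Suc i)) \<omega> - B (t i) \<omega>) {..<n}) \<and>
     (\<forall>s t. 0 \<le> s \<and> s < t \<longrightarrow>
        distributed M lborel (\<lambda>\<omega>. B t \<omega> - B s \<omega>)
          (\<lambda>v. ennreal (\<Prod>b\<in>Basis. normal_density 0 (sqrt (t - s)) (v \<bullet> b))))"

subsection \<open>The Brownian mechanism\<close>

definition time_functions :: "(nat \<Rightarrow> (nat \<Rightarrow> 'v::euclidean_space) \<Rightarrow> real) \<Rightarrow> bool" where
  "time_functions T \<longleftrightarrow>
     (\<forall>n\<ge>1. T n \<in> borel_measurable (PiM {1..<n} (\<lambda>_. borel))) \<and>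
     (\<forall>n\<ge>1. \<forall>\<beta>\<in>space (PiM {1..<n} (\<lambda>_. borel :: 'v measure)). 0 < T n \<beta>) \<and>
     (\<forall>n\<ge>1. \<forall>\<beta>\<in>space (PiM {1..n} (\<lambda>_. borel :: 'v measure)).
        T (Suc n) \<beta> \<le> T n (restrict \<beta> {1..<n}))"

lemma restrict_fundef_cong [fundef_cong]:
  "I = J \<Longrightarrow> (\<And>i. i \<in> J \<Longrightarrow> g i = h i) \<Longrightarrow> restrict g I = restrict h J"
  by (auto simp: restrict_def)

text \<open>The value at the index \<open>n = 0\<close> is meaningless and never used.\<close>

fun BM :: "('x \<Rightarrow> 'v::euclidean_space) \<Rightarrow> (nat \<Rightarrow> (nat \<Rightarrow> 'v) \<Rightarrow> real) \<Rightarrow> (real \<Rightarrow> 'a \<Rightarrow> 'v)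
    \<Rightarrow> 'x \<Rightarrow> nat \<Rightarrow> 'a \<Rightarrow> 'v" where
  "BM f T B x n \<omega> = f x + B (T n (\<lambda>i\<in>{1..<n}. BM f T B x i \<omega>)) \<omega>"

declare BM.simps [simp del]

definition BM_time :: "('x \<Rightarrow> 'v::euclidean_space) \<Rightarrow> (nat \<Rightarrow> (nat \<Rightarrow> 'v) \<Rightarrow> real)
    \<Rightarrow> (real \<Rightarrow> 'a \<Rightarrow> 'v) \<Rightarrow> 'x \<Rightarrow> nat \<Rightarrow> 'a \<Rightarrow> real" where
  "BM_time f T B x n \<omega> = T n (\<lambda>i\<in>{1..<n}. BM f T B x i \<omega>)"

subsection \<open>Stopping functions\<close>

definition generated_filtration :: "'a measure \<Rightarrow> (nat \<Rightarrow> 'a \<Rightarrow> 'v::euclidean_space) \<Rightarrow> nat \<Rightarrow> 'a measure" where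
  "generated_filtration M Y n =
     sigma (space M) (\<Union>i\<in>{1..n}. {Y i -` U \<inter> space M | U. U \<in> sets borel})"

definition stop_index :: "('x \<Rightarrow> 'v::euclidean_space) \<Rightarrow> (nat \<Rightarrow> (nat \<Rightarrow> 'v) \<Rightarrow> real)
    \<Rightarrow> (real \<Rightarrow> 'a \<Rightarrow> 'v) \<Rightarrow> ((nat \<Rightarrow> 'v) \<Rightarrow> nat) \<Rightarrow> 'x \<Rightarrow> 'a \<Rightarrow> nat" where
  "stop_index f T B N x \<omega> = N (\<lambda>i\<in>{1..}. BM f T B x i \<omega>)"

definition stopped_time :: "('x \<Rightarrow> 'v::euclidean_space) \<Rightarrow> (nat \<Rightarrow> (nat \<Rightarrow> 'v) \<Rightarrow> real)
    \<Rightarrow> (real \<Rightarrow> 'a \<Rightarrow> 'v) \<Rightarrow> ((nat \<Rightarrow> 'v) \<Rightarrow> nat) \<Rightarrow> 'x \<Rightarrow> 'a \<Rightarrow> real" where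
  "stopped_time f T B N x \<omega> = BM_time f T B x (stop_index f T B N x \<omega>) \<omega>"

text \<open>
  The filtration is trivial at the additional index \<open>0\<close>, where \<open>N(x) \<le> 0\<close> is impossible, so
  \<^const>\<open>stopping_time\<close> is the notion for the filtration indexed by \<open>n \<ge> 1\<close>.

  That \<open>N(x)\<close> is a stopping time means that for every \<open>n\<close> the event \<open>N(x) \<le> n\<close> is of the form
  \<open>BM\<^sub>1\<^sub>:\<^sub>n(x) \<in> C\<close> with \<open>C\<close> a Borel set.  The last conjunct says that this set \<open>C\<close>, the rule by
  which one stops, does not depend on the database \<open>x\<close>.  This does not follow from the
  stopping time property for each \<open>x\<close> separately: for \<open>T\<^sub>n = 1/n\<close> the outputs
  \<open>BM\<^sub>n(y)\<close> converge to \<open>f y\<close>, so the function \<open>N\<close> which is \<open>1\<close> on the sequences with limit \<open>f x\<close>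
  and \<open>2\<close> on all others yields a constant \<open>N(y)\<close> for every \<open>y\<close>, but the privacy loss between \<open>x\<close>
  and \<open>x'\<close> is infinite if \<open>f x' \<noteq> f x\<close>.  It does follow if \<open>N\<close> is a stopping time for the coordinate filtration of the
  space of sequences.
\<close>

definition stopping_function :: "'a measure \<Rightarrow> 'x set \<Rightarrow> ('x \<Rightarrow> 'v::euclidean_space)
    \<Rightarrow> (nat \<Rightarrow> (nat \<Rightarrow> 'v) \<Rightarrow> real) \<Rightarrow> (real \<Rightarrow> 'a \<Rightarrow> 'v) \<Rightarrow> ((nat \<Rightarrow> 'v) \<Rightarrow> nat) \<Rightarrow> bool" where
  "stopping_function M X f T B N \<longleftrightarrow>
     (\<forall>\<beta>\<in>space (PiM {1..} (\<lambda>_. borel :: 'v measure)). 1 \<le> N \<beta>) \<and>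
     (\<forall>x\<in>X. stopping_time (generated_filtration M (BM f T B x)) (stop_index f T B N x)) \<and>
     (\<forall>n\<ge>1. \<exists>C\<in>sets (PiM {1..n} (\<lambda>_. borel :: 'v measure)). \<forall>x\<in>X. \<forall>\<omega>\<in>space M.
        stop_index f T B N x \<omega> \<le> n \<longleftrightarrow> (\<lambda>i\<in>{1..n}. BM f T B x i \<omega>) \<in> C)"

text \<open>
  The disjoint union of the spaces of \<open>n\<close>-tuples, \<open>n \<ge> 1\<close>, an \<open>n\<close>-tuple being tagged by its
  length.
\<close>

definition tuple_space :: "(nat \<times> (nat \<Rightarrow> 'v::euclidean_space)) measure" where
  "tuple_space =
     sigma (SIGMA n:{1..}. space (PiM {1..n} (\<lambda>_. borel)))
       {{n} \<times> C | n C. 1 \<le> n \<and> C \<in> sets (PiM {1..n} (\<lambda>_. borel))}"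

definition stopped_BM :: "('x \<Rightarrow> 'v::euclidean_space) \<Rightarrow> (nat \<Rightarrow> (nat \<Rightarrow> 'v) \<Rightarrow> real)
    \<Rightarrow> (real \<Rightarrow> 'a \<Rightarrow> 'v) \<Rightarrow> ((nat \<Rightarrow> 'v) \<Rightarrow> nat) \<Rightarrow> 'x \<Rightarrow> 'a \<Rightarrow> nat \<times> (nat \<Rightarrow> 'v)" where
  "stopped_BM f T B N x \<omega> =
     (stop_index f T B N x \<omega>, \<lambda>i\<in>{1..stop_index f T B N x \<omega>}. BM f T B x i \<omega>)"

subsection \<open>Sensitivity\<close>

text \<open>The supremum may be infinite, hence the extended reals.\<close>

definition l2_sensitivity ::
    "'x set \<Rightarrow> ('x \<Rightarrow> 'x \<Rightarrow> bool) \<Rightarrow> ('x \<Rightarrow> 'v::euclidean_space) \<Rightarrow> ereal" where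
  "l2_sensitivity X nbr f =
     (SUP (y, y')\<in>{(y, y'). y \<in> X \<and> y' \<in> X \<and> nbr y y'}. ereal (norm (f y - f y')))"

end

theory Submission
  imports Defs
begin

text \<open>
  Run backwards in time, the \<open>T\<^sub>n\<close> are stopping times: the outputs \<open>BM\<^sub>1, \<dots>, BM\<^sub>n\<close> and the time
  \<open>T\<^sub>n\<close> only depend on the path \<open>a + B\<close>, \<open>a = f x\<close>, after time \<open>T\<^sub>n\<close>.  For a fixed \<open>s > 0\<close> the laws
  of \<open>a + B\<close> and \<open>a' + B\<close> on the times \<open>\<ge> s\<close> have the density
  \<open>R\<^sub>s(y) = exp ((\<parallel>y - a'\<parallel>\<^sup>2 - \<parallel>y - a\<parallel>\<^sup>2) / (2 s))\<close>, \<open>y\<close> the value at time \<open>s\<close>, because the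
  increments after \<open>s\<close> are independent of the value at \<open>s\<close>.  Rounding \<open>T\<^sub>n\<close> down to a grid and
  passing to the limit gives the density \<open>R\<close> at the random time \<open>T\<^sub>n\<close>, first for events on which
  \<open>T\<^sub>n\<close> is bounded away from \<open>0\<close> and \<open>BM\<^sub>n\<close> is bounded, where \<open>R\<close> is bounded.  Since \<open>N = n\<close> is
  an event in \<open>BM\<^sub>1\<^sub>:\<^sub>n\<close>, the same density holds for the stopped sequence, and its logarithm at
  \<open>y = a + B\<^sub>T\<close> is the claimed expression with \<open>W = u \<bullet> B\<close>, \<open>u\<close> the direction of \<open>a - a'\<close>.
\<close>

subsection \<open>One-dimensional projections of Brownian motion\<close>

text \<open>Density and indicator of the box are both products over the coordinates, so the integral
  splits into one-dimensional integrals.\<close>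

lemma (in prob_space) gaussian_rectangle:
  fixes Z :: "'a \<Rightarrow> 'v::euclidean_space"
  assumes D: "distributed M lborel Z (\<lambda>v. ennreal (\<Prod>b\<in>Basis. normal_density 0 \<sigma> (v \<bullet> b)))"
    and A: "\<And>b. b \<in> Basis \<Longrightarrow> A b \<in> sets borel"
  shows "emeasure M {\<omega>\<in>space M. \<forall>b\<in>Basis. Z \<omega> \<bullet> b \<in> A b} =
    (\<Prod>b\<in>Basis. \<integral>\<^sup>+y. ennreal (normal_density 0 \<sigma> y) * indicator (A b) y \<partial>lborel)"
proof -
  have [measurable]: "\<And>b. b \<in> Basis \<Longrightarrow> A b \<in> sets borel"
    by (fact A)
  have meas: "{v. \<forall>b\<in>Basis. v \<bullet> b \<in> A b} \<in> sets lborel"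
    by measurable
  have "{\<omega>\<in>space M. \<forall>b\<in>Basis. Z \<omega> \<bullet> b \<in> A b} = Z -` {v. \<forall>b\<in>Basis. v \<bullet> b \<in> A b} \<inter> space M"
    by auto
  then have "emeasure M {\<omega>\<in>space M. \<forall>b\<in>Basis. Z \<omega> \<bullet> b \<in> A b} =
      (\<integral>\<^sup>+v. ennreal (\<Prod>b\<in>Basis. normal_density 0 \<sigma> (v \<bullet> b)) *
        indicator {v. \<forall>b\<in>Basis. v \<bullet> b \<in> A b} v \<partial>lborel)"
    using distributed_emeasure[OF D meas] by simp
  also have "\<dots> = (\<integral>\<^sup>+v. (\<Prod>b\<in>Basis. ennreal (normal_density 0 \<sigma> (v \<bullet> b)) * indicator (A b) (v \<bullet> b)) \<partial>lborel)"
    by (intro nn_integral_cong)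
      (auto simp: prod.distrib prod_ennreal indicator_def split: if_splits)
  also have "\<dots> = (\<Prod>b\<in>Basis. \<integral>\<^sup>+y. ennreal (normal_density 0 \<sigma> y) * indicator (A b) y \<partial>lborel)"
    by (rule nn_integral_lborel_prod) auto
  finally show ?thesis .
qed

text \<open>Everything is read off from boxes: with all sides but one equal to \<open>UNIV\<close>
  they give the marginals, and the general box then exhibits the joint law as the product of the
  marginals, which is independence.\<close>

lemma (in prob_space) gaussian_coordinates:
  fixes Z :: "'a \<Rightarrow> 'v::euclidean_space"
  assumes D: "distributed M lborel Z (\<lambda>v. ennreal (\<Prod>b\<in>Basis. normal_density 0 \<sigma> (v \<bullet> b)))"
    and \<sigma>: "0 < \<sigma>"
  shows "\<And>b. b \<in> Basis \<Longrightarrow> distributed M lborel (\<lambda>\<omega>. Z \<omega> \<bullet> b) (normal_density 0 \<sigma>)"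
    and "indep_vars (\<lambda>_. borel) (\<lambda>b \<omega>. Z \<omega> \<bullet> b) Basis"
proof -
  have [measurable]: "Z \<in> borel_measurable M"
    using distributed_measurable[OF D] by simp
  have one: "(\<integral>\<^sup>+y. ennreal (normal_density 0 \<sigma> y) \<partial>lborel) = 1"
    using prob_space_normal_density[OF \<sigma>, of 0]
    by (auto dest!: prob_space.emeasure_space_1 simp: emeasure_density)
  have marg: "emeasure M {\<omega>\<in>space M. Z \<omega> \<bullet> b \<in> S} =
      (\<integral>\<^sup>+y. ennreal (normal_density 0 \<sigma> y) * indicator S y \<partial>lborel)"
    if b: "b \<in> Basis" and S: "S \<in> sets borel" for b S
  proof -
    have "{\<omega>\<in>space M. Z \<omega> \<bullet> b \<in> S} =
        {\<omega>\<in>space M. \<forall>c\<in>Basis. Z \<omega> \<bullet> c \<in> (if c = b then S else UNIV)}"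
      using b by auto
    also have "emeasure M \<dots> = (\<Prod>c\<in>Basis. \<integral>\<^sup>+y. ennreal (normal_density 0 \<sigma> y) *
        indicator (if c = b then S else UNIV) y \<partial>lborel)"
      using S by (intro gaussian_rectangle[OF D]) auto
    also have "\<dots> = (\<Prod>c\<in>Basis. if c = b then
        \<integral>\<^sup>+y. ennreal (normal_density 0 \<sigma> y) * indicator S y \<partial>lborel else 1)"
      by (intro prod.cong) (auto simp: one)
    finally show ?thesis
      using b by simp
  qed
  show "distributed M lborel (\<lambda>\<omega>. Z \<omega> \<bullet> b) (normal_density 0 \<sigma>)" if b: "b \<in> Basis" for b
    unfolding distributed_def
  proof (intro conjI measure_eqI)
    fix S assume "S \<in> sets (distr M lborel (\<lambda>\<omega>. Z \<omega> \<bullet> b))"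
    then have S: "S \<in> sets borel" by simp
    have "(\<lambda>\<omega>. Z \<omega> \<bullet> b) -` S \<inter> space M = {\<omega>\<in>space M. Z \<omega> \<bullet> b \<in> S}"
      by auto
    then show "emeasure (distr M lborel (\<lambda>\<omega>. Z \<omega> \<bullet> b)) S =
        emeasure (density lborel (\<lambda>y. ennreal (normal_density 0 \<sigma> y))) S"
      using S marg[OF b S] by (simp add: emeasure_distr emeasure_density)
  qed auto
  show "indep_vars (\<lambda>_. borel) (\<lambda>b \<omega>. Z \<omega> \<bullet> b) Basis"
  proof (subst indep_vars_iff_distr_eq_PiM')
    interpret P: product_prob_space "\<lambda>b. distr M borel (\<lambda>\<omega>. Z \<omega> \<bullet> b)" Basis
      by (intro product_prob_spaceI prob_space_distr) auto
    show "distr M (Pi\<^sub>M Basis (\<lambda>_. borel)) (\<lambda>\<omega>. \<lambda>b\<in>Basis. Z \<omega> \<bullet> b) =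
        Pi\<^sub>M Basis (\<lambda>b. distr M borel (\<lambda>\<omega>. Z \<omega> \<bullet> b))"
    proof (rule P.PiM_eqI)
      fix A assume A: "\<And>b. b \<in> Basis \<Longrightarrow> A b \<in> sets (distr M borel (\<lambda>\<omega>. Z \<omega> \<bullet> b))"
      then have A': "\<And>b. b \<in> Basis \<Longrightarrow> A b \<in> sets borel" by simp
      have "emeasure (distr M (Pi\<^sub>M Basis (\<lambda>_. borel)) (\<lambda>\<omega>. \<lambda>b\<in>Basis. Z \<omega> \<bullet> b)) (Pi\<^sub>E Basis A) =
          emeasure M {\<omega>\<in>space M. \<forall>b\<in>Basis. Z \<omega> \<bullet> b \<in> A b}"
        using A' by (subst emeasure_distr)
          (auto intro!: arg_cong[where f="emeasure M"] sets_PiM_I_finite simp: PiE_iff)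
      also have "\<dots> = (\<Prod>b\<in>Basis. emeasure M {\<omega>\<in>space M. Z \<omega> \<bullet> b \<in> A b})"
        using A' by (simp add: gaussian_rectangle[OF D] marg)
      also have "\<dots> = (\<Prod>b\<in>Basis. emeasure (distr M borel (\<lambda>\<omega>. Z \<omega> \<bullet> b)) (A b))"
        using A' by (intro prod.cong refl)
          (auto simp: emeasure_distr intro!: arg_cong[where f="emeasure M"])
      finally show "emeasure (distr M (Pi\<^sub>M Basis (\<lambda>_. borel)) (\<lambda>\<omega>. \<lambda>b\<in>Basis. Z \<omega> \<bullet> b)) (Pi\<^sub>E Basis A) =
          (\<Prod>b\<in>Basis. emeasure (distr M borel (\<lambda>\<omega>. Z \<omega> \<bullet> b)) (A b))" .
    qed (auto intro!: sets_PiM_cong)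
  qed auto
qed

text \<open>A projection on a unit vector is a sum of independent centred normals
  \<open>(u \<bullet> b) * (Z \<omega> \<bullet> b)\<close>, whose variances add up to
  \<open>\<sigma>\<^sup>2 * (norm u)\<^sup>2\<close>.\<close>

lemma (in prob_space) distributed_inner_gaussian:
  fixes Z :: "'a \<Rightarrow> 'v::euclidean_space"
  assumes D: "distributed M lborel Z (\<lambda>v. ennreal (\<Prod>b\<in>Basis. normal_density 0 \<sigma> (v \<bullet> b)))"
    and \<sigma>: "0 < \<sigma>" and u: "norm u = 1"
  shows "distributed M lborel (\<lambda>\<omega>. u \<bullet> Z \<omega>) (normal_density 0 \<sigma>)"
proof -
  \<comment> \<open>Coordinates with \<open>u \<bullet> b = 0\<close> are left out, since their
    terms are constant and have no normal density.\<close>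
  define J where "J = {b\<in>Basis. u \<bullet> b \<noteq> 0}"
  have J: "J \<subseteq> Basis" "finite J"
    by (auto simp: J_def)
  have sq: "(\<Sum>b\<in>J. (u \<bullet> b)\<^sup>2) = 1"
  proof -
    have "(\<Sum>b\<in>J. (u \<bullet> b)\<^sup>2) = (\<Sum>b\<in>Basis. (u \<bullet> b)\<^sup>2)"
      by (intro sum.mono_neutral_left) (auto simp: J_def)
    also have "\<dots> = (norm u)\<^sup>2"
      by (subst power2_norm_eq_inner, subst euclidean_inner) (simp add: power2_eq_square)
    finally show ?thesis
      using u by simp
  qed
  then have "J \<noteq> {}"
    by (metis sum.empty zero_neq_one)
  have "distributed M lborel (\<lambda>\<omega>. \<Sum>b\<in>J. (u \<bullet> b) * (Z \<omega> \<bullet> b))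
      (normal_density (\<Sum>b\<in>J. 0) (sqrt (\<Sum>b\<in>J. (\<bar>u \<bullet> b\<bar> * \<sigma>)\<^sup>2)))"
  proof (rule sum_indep_normal)
    show "indep_vars (\<lambda>_. borel) (\<lambda>b \<omega>. (u \<bullet> b) * (Z \<omega> \<bullet> b)) J"
      using indep_vars_compose2[OF indep_vars_subset[OF gaussian_coordinates(2)[OF D \<sigma>] J(1)],
          of "\<lambda>b y. (u \<bullet> b) * y" "\<lambda>_. borel"]
      by simp
    show "distributed M lborel (\<lambda>\<omega>. (u \<bullet> b) * (Z \<omega> \<bullet> b)) (normal_density 0 (\<bar>u \<bullet> b\<bar> * \<sigma>))"
      if "b \<in> J" for b
      using normal_density_affine[OF gaussian_coordinates(1)[OF D \<sigma>, of b] \<sigma>, of "u \<bullet> b" 0] that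
      by (simp add: J_def)
  qed (use J \<open>J \<noteq> {}\<close> \<sigma> in \<open>auto simp: J_def\<close>)
  moreover have "(\<Sum>b\<in>J. (u \<bullet> b) * (Z \<omega> \<bullet> b)) = u \<bullet> Z \<omega>" for \<omega>
    by (subst euclidean_inner, intro sum.mono_neutral_left) (auto simp: J_def)
  moreover have "(\<Sum>b\<in>J. (\<bar>u \<bullet> b\<bar> * \<sigma>)\<^sup>2) = \<sigma>\<^sup>2"
    using sq by (simp add: power_mult_distrib sum_distrib_right[symmetric])
  ultimately show ?thesis
    using \<sigma> by simp
qed

text \<open>This yields the univariate motion \<open>W\<close> of the theorem. Increments of the
  projection are projections of increments, so independence and normality are inherited.\<close>

lemma standard_brownian_motion_inner:
  fixes B :: "real \<Rightarrow> 'a \<Rightarrow> 'v::euclidean_space"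
  assumes B: "standard_brownian_motion M B" and u: "norm u = 1"
  shows "standard_brownian_motion M (\<lambda>t \<omega>. u \<bullet> B t \<omega>)"
proof -
  interpret prob_space M
    using B by (simp add: standard_brownian_motion_def)
  have [measurable]: "\<And>t. 0 \<le> t \<Longrightarrow> B t \<in> borel_measurable M"
    using B by (simp add: standard_brownian_motion_def)
  have ind: "indep_vars (\<lambda>_. borel) (\<lambda>i \<omega>. u \<bullet> B (t (Suc i)) \<omega> - u \<bullet> B (t i) \<omega>) {..<n}"
    if "0 \<le> t 0" "mono t" for t n
  proof -
    have "indep_vars (\<lambda>_. borel) (\<lambda>i \<omega>. B (t (Suc i)) \<omega> - B (t i) \<omega>) {..<n}"
      using B that by (simp add: standard_brownian_motion_def)
    then have "indep_vars (\<lambda>_. borel) (\<lambda>i \<omega>. u \<bullet> (B (t (Suc i)) \<omega> - B (t i) \<omega>)) {..<n}"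
      by (rule indep_vars_compose2) simp
    then show ?thesis
      by (simp add: inner_diff_right)
  qed
  have dist: "distributed M lborel (\<lambda>\<omega>. u \<bullet> B t \<omega> - u \<bullet> B s \<omega>) (normal_density 0 (sqrt (t - s)))"
    if st: "0 \<le> s" "s < t" for s t
  proof -
    have "distributed M lborel (\<lambda>\<omega>. B t \<omega> - B s \<omega>)
        (\<lambda>v. ennreal (\<Prod>b\<in>Basis. normal_density 0 (sqrt (t - s)) (v \<bullet> b)))"
      using B st by (simp add: standard_brownian_motion_def)
    from distributed_inner_gaussian[OF this _ u] st show ?thesis
      by (simp add: inner_diff_right)
  qed
  have "continuous_on {0..} (\<lambda>t. u \<bullet> B t \<omega>)" if "\<omega> \<in> space M" for \<omega>
    using B that by (intro continuous_intros) (simp add: standard_brownian_motion_def)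
  then show ?thesis
    using B ind dist prob_space_axioms
    by (simp add: standard_brownian_motion_def)
qed

subsection \<open>The mechanism as a functional of a path\<close>

text \<open>The least multiple of \<open>1 / real (Suc j)\<close> strictly above \<open>t\<close>.
  Strictness ensures that a limit along these times reads only the path after
  \<open>t\<close>.\<close>

definition upper_grid :: "nat \<Rightarrow> real \<Rightarrow> real" where
  "upper_grid j t = of_int (\<lfloor>real (Suc j) * t\<rfloor> + 1) / real (Suc j)"

lemma upper_grid_bounds: "t < upper_grid j t" "upper_grid j t \<le> t + 1 / real (Suc j)"
proof -
  have "real (Suc j) * t < of_int (\<lfloor>real (Suc j) * t\<rfloor> + 1)"
    by linarith
  then show "t < upper_grid j t"
    unfolding upper_grid_def by (subst pos_less_divide_eq) (auto simp: mult.commute)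
  have "of_int (\<lfloor>real (Suc j) * t\<rfloor> + 1) \<le> real (Suc j) * t + 1"
    by linarith
  also have "\<dots> = (t + 1 / real (Suc j)) * real (Suc j)"
    by (simp add: field_simps)
  finally show "upper_grid j t \<le> t + 1 / real (Suc j)"
    unfolding upper_grid_def by (subst pos_divide_le_eq) auto
qed

lemma upper_grid_tendsto: "(\<lambda>j. upper_grid j t) \<longlonglongrightarrow> t"
proof (rule tendsto_sandwich[where f="\<lambda>_. t" and h="\<lambda>j. t + 1 / real (Suc j)"])
  show "(\<lambda>j. t + 1 / real (Suc j)) \<longlonglongrightarrow> t"
    using tendsto_add[OF tendsto_const[of t] LIMSEQ_inverse_real_of_nat] by (simp add: inverse_eq_divide)
  show "\<forall>\<^sub>F j in sequentially. t \<le> upper_grid j t"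
    by (intro always_eventually allI less_imp_le upper_grid_bounds)
  show "\<forall>\<^sub>F j in sequentially. upper_grid j t \<le> t + 1 / real (Suc j)"
    by (intro always_eventually allI upper_grid_bounds)
qed simp

text \<open>
  The value at time \<open>t\<close> of a right-continuous path, as a limit along a countable set of times;
  unlike plain evaluation it is jointly measurable for the product \<open>\<sigma>\<close>-algebra on paths.
\<close>

definition path_at :: "real \<Rightarrow> (real \<Rightarrow> 'v::euclidean_space) \<Rightarrow> 'v" where
  "path_at t w = lim (\<lambda>j. w (upper_grid j t))"

abbreviation path_space :: "(real \<Rightarrow> 'v::euclidean_space) measure" where
  "path_space \<equiv> PiM UNIV (\<lambda>_. borel)"

lemma measurable_pathI:
  assumes "\<And>d. Z d \<in> borel_measurable N"
  shows "(\<lambda>x d. Z d x) \<in> N \<rightarrow>\<^sub>M path_space"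
  using measurable_restrict[of UNIV Z N "\<lambda>_. borel"] assms by (simp add: restrict_def)

lemma measurable_path_at:
  assumes [measurable]: "\<tau> \<in> borel_measurable N" "\<And>d. Z d \<in> borel_measurable N"
  shows "(\<lambda>x. path_at (\<tau> x) (\<lambda>d. Z d x)) \<in> borel_measurable N"
  unfolding path_at_def
proof (rule borel_measurable_lim_metric)
  fix j
  \<comment> \<open>The rounded time takes countably many values, so the path at that time is
    patched together from countably many coordinates.\<close>
  have "(\<lambda>x. Z (of_int (\<lfloor>real (Suc j) * \<tau> x\<rfloor> + 1) / real (Suc j)) x) \<in> borel_measurable N"
    by (rule measurable_compose_countable[where f="\<lambda>i x. Z (of_int (i + 1) / real (Suc j)) x"])
      measurable
  then show "(\<lambda>x. Z (upper_grid j (\<tau> x)) x) \<in> borel_measurable N"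
    by (simp add: upper_grid_def)
qed

text \<open>The recursion of the mechanism is reused with the path itself as sample point,
  \<open>path_at\<close> as the process, a dummy database and shift \<open>0\<close>; the starting
  point is part of the path. This makes times and outputs functionals of the path alone.\<close>

definition sample_time :: "(nat \<Rightarrow> (nat \<Rightarrow> 'v::euclidean_space) \<Rightarrow> real) \<Rightarrow> nat \<Rightarrow> (real \<Rightarrow> 'v) \<Rightarrow> real" where
  "sample_time T n w = BM_time (\<lambda>_. 0) T path_at () n w"

definition sample :: "(nat \<Rightarrow> (nat \<Rightarrow> 'v::euclidean_space) \<Rightarrow> real) \<Rightarrow> nat \<Rightarrow> (real \<Rightarrow> 'v) \<Rightarrow> 'v" where
  "sample T n w = BM (\<lambda>_. 0) T path_at () n w"

lemma sample_time_eq: "sample_time T n w = T n (\<lambda>i\<in>{1..<n}. sample T i w)"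
  by (simp add: sample_time_def sample_def BM_time_def)

lemma sample_eq: "sample T n w = path_at (sample_time T n w) w"
  unfolding sample_def sample_time_def BM_time_def by (subst BM.simps) simp

lemma measurable_sample:
  assumes T: "time_functions T" and "1 \<le> n"
  shows "sample T n \<in> borel_measurable path_space"
  using \<open>1 \<le> n\<close>
proof (induction n rule: less_induct)
  case (less n)
  have "(\<lambda>w. \<lambda>i\<in>{1..<n}. sample T i w) \<in> path_space \<rightarrow>\<^sub>M PiM {1..<n} (\<lambda>_. borel)"
    using less by (intro measurable_restrict) auto
  moreover have "T n \<in> borel_measurable (PiM {1..<n} (\<lambda>_. borel))"
    using T less.prems by (simp add: time_functions_def)
  ultimately have "sample_time T n \<in> borel_measurable path_space"
    unfolding sample_time_eq by (rule measurable_compose)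
  then have "(\<lambda>w. path_at (sample_time T n w) (\<lambda>d. w d)) \<in> borel_measurable path_space"
    by (rule measurable_path_at) (rule measurable_component_singleton, simp)
  then show ?case
    by (simp add: sample_eq[abs_def])
qed

lemma measurable_sample_restrict:
  assumes "time_functions T" and "\<And>i. i \<in> I \<Longrightarrow> 1 \<le> i"
  shows "(\<lambda>w. \<lambda>i\<in>I. sample T i w) \<in> path_space \<rightarrow>\<^sub>M PiM I (\<lambda>_. borel)"
  using assms by (intro measurable_restrict measurable_sample) auto

lemma measurable_sample_time:
  assumes T: "time_functions T" and "1 \<le> n"
  shows "sample_time T n \<in> borel_measurable path_space"
  unfolding sample_time_eq
  by (rule measurable_compose[OF measurable_sample_restrict[OF T]])
    (use assms in \<open>auto simp: time_functions_def\<close>)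

lemma sample_time_pos:
  assumes "time_functions T" and "1 \<le> n"
  shows "0 < sample_time T n w"
  using assms by (auto simp: sample_time_eq time_functions_def space_PiM)

lemma sample_time_decreasing:
  assumes T: "time_functions T" and "1 \<le> i" "i \<le> n"
  shows "sample_time T n w \<le> sample_time T i w"
  using \<open>i \<le> n\<close>
proof (induction n rule: dec_induct)
  case (step n)
  let ?\<beta> = "\<lambda>i\<in>{1..n}. sample T i w"
  have "T (Suc n) ?\<beta> \<le> T n (restrict ?\<beta> {1..<n})"
    using T step.hyps \<open>1 \<le> i\<close> unfolding time_functions_def by (simp add: space_PiM del: restrict_restrict)
  moreover have "restrict ?\<beta> {1..<n} = (\<lambda>i\<in>{1..<n}. sample T i w)"
    by (auto simp: restrict_def)
  ultimately have "sample_time T (Suc n) w \<le> sample_time T n w"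
    by (simp add: sample_time_eq atLeastLessThanSuc_atLeastAtMost)
  then show ?case
    using step.IH by simp
qed simp

text \<open>This is the backward stopping property. Times decrease in the index, so \<open>s\<close>
  lies below all of the first \<open>n\<close> times along \<open>w\<close>; the recursion then
  reads only values on which the two paths agree.\<close>

lemma sample_cong:
  assumes T: "time_functions T" and w: "\<And>t. s \<le> t \<Longrightarrow> path_at t w = path_at t w'"
    and s: "s \<le> sample_time T n w" and "1 \<le> i" "i \<le> n"
  shows "sample T i w' = sample T i w"
  using \<open>1 \<le> i\<close> \<open>i \<le> n\<close>
proof (induction i rule: less_induct)
  case (less i)
  have "(\<lambda>k\<in>{1..<i}. sample T k w') = (\<lambda>k\<in>{1..<i}. sample T k w)"
    using less by (auto intro!: restrict_ext)
  then have "sample_time T i w' = sample_time T i w"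
    by (simp add: sample_time_eq)
  moreover have "s \<le> sample_time T i w"
    using s sample_time_decreasing[OF T less.prems, of w] by simp
  ultimately show ?case
    using w by (simp add: sample_eq)
qed

lemma sample_time_cong:
  assumes T: "time_functions T" and w: "\<And>t. s \<le> t \<Longrightarrow> path_at t w = path_at t w'"
    and s: "s \<le> sample_time T n w" and "1 \<le> n"
  shows "sample_time T n w' = sample_time T n w"
proof -
  have "(\<lambda>k\<in>{1..<n}. sample T k w') = (\<lambda>k\<in>{1..<n}. sample T k w)"
    using sample_cong[OF T w s] by (auto intro!: restrict_ext)
  then show ?thesis
    by (simp add: sample_time_eq)
qed

subsection \<open>Change of the starting point at a fixed time\<close>

text \<open>Freezing the path before \<open>s\<close> at its value at \<open>s\<close> leaves
  exactly the information from time \<open>s\<close> on. With \<open>s = 0\<close> the whole motion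
  started at \<open>a\<close> is kept, negative times being frozen.\<close>

definition path_from :: "(real \<Rightarrow> 'a \<Rightarrow> 'v::euclidean_space) \<Rightarrow> 'v \<Rightarrow> real \<Rightarrow> 'a \<Rightarrow> real \<Rightarrow> 'v" where
  "path_from B a s \<omega> = (\<lambda>d. a + B (max d s) \<omega>)"

text \<open>The quotient at \<open>y\<close> of the densities of the normal laws with means
  \<open>a\<close> and \<open>a'\<close> and covariance \<open>s\<close> times the identity.\<close>

definition gaussian_ratio :: "'v::euclidean_space \<Rightarrow> 'v \<Rightarrow> real \<Rightarrow> 'v \<Rightarrow> real" where
  "gaussian_ratio a a' s y = exp (((norm (y - a'))\<^sup>2 - (norm (y - a))\<^sup>2) / (2 * s))"

lemma gaussian_ratio_pos: "0 < gaussian_ratio a a' s y"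
  by (simp add: gaussian_ratio_def)

lemma gaussian_ratio_density:
  fixes y :: "'v::euclidean_space"
  assumes "0 < s"
  shows "(\<Prod>b\<in>Basis. normal_density 0 (sqrt s) ((y - a) \<bullet> b)) =
    gaussian_ratio a a' s y * (\<Prod>b\<in>Basis. normal_density 0 (sqrt s) ((y - a') \<bullet> b))"
proof -
  \<comment> \<open>The product density depends only on the norm of its argument, so in the quotient
    of the two shifted densities the normalizing constants cancel.\<close>
  have *: "(\<Prod>b\<in>Basis. normal_density 0 (sqrt s) (v \<bullet> b)) =
      (1 / sqrt (2 * pi * s)) ^ DIM('v) * exp (- (norm v)\<^sup>2 / (2 * s))" for v :: 'v
  proof -
    have "(\<Prod>b\<in>Basis. normal_density 0 (sqrt s) (v \<bullet> b)) =
        (1 / sqrt (2 * pi * s)) ^ DIM('v) * exp (\<Sum>b\<in>Basis. - (v \<bullet> b)\<^sup>2 / (2 * s))"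
      using assms by (simp add: normal_density_def prod.distrib exp_sum prod_dividef power_one_over)
    also have "(\<Sum>b\<in>Basis. - (v \<bullet> b)\<^sup>2 / (2 * s)) = - (norm v)\<^sup>2 / (2 * s)"
      by (subst power2_norm_eq_inner, subst euclidean_inner)
        (simp add: power2_eq_square sum_negf sum_divide_distrib)
    finally show ?thesis .
  qed
  have "- (norm (y - a))\<^sup>2 / (2 * s) =
      ((norm (y - a'))\<^sup>2 - (norm (y - a))\<^sup>2) / (2 * s) + - (norm (y - a'))\<^sup>2 / (2 * s)"
    by (simp add: diff_divide_distrib)
  then show ?thesis
    unfolding * gaussian_ratio_def by (simp only: exp_add) simp
qed

locale brownian_motion =
  fixes M :: "'a measure" and B :: "real \<Rightarrow> 'a \<Rightarrow> 'v::euclidean_space"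
  assumes brownian: "standard_brownian_motion M B"
begin

sublocale prob_space M
  using brownian by (simp add: standard_brownian_motion_def)

lemma measurable_B [measurable]: "0 \<le> t \<Longrightarrow> B t \<in> borel_measurable M"
  using brownian by (simp add: standard_brownian_motion_def)

text \<open>The grid times exceed \<open>t\<close>, hence \<open>s\<close>, so the freezing is not
  seen by the limit; continuity of the Brownian path then identifies it.\<close>

lemma path_at_path_from:
  assumes "\<omega> \<in> space M" "0 \<le> s" "s \<le> t"
  shows "path_at t (path_from B a s \<omega>) = a + B t \<omega>"
  unfolding path_at_def
proof (rule limI)
  have gt: "s < upper_grid j t" for j
    using upper_grid_bounds(1)[of t j] assms by simp
  have "(\<lambda>j. B (upper_grid j t) \<omega>) \<longlonglongrightarrow> B t \<omega>"
  proof (rule continuous_on_tendsto_compose[where f="\<lambda>t. B t \<omega>"])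
    show "continuous_on {0..} (\<lambda>t. B t \<omega>)"
      using brownian assms by (simp add: standard_brownian_motion_def)
    show "\<forall>\<^sub>F j in sequentially. upper_grid j t \<in> {0..}"
      using order.strict_trans1[OF \<open>0 \<le> s\<close> gt] by (simp add: less_imp_le)
  qed (use assms upper_grid_tendsto in auto)
  then have "(\<lambda>j. a + B (upper_grid j t) \<omega>) \<longlonglongrightarrow> a + B t \<omega>"
    by (rule tendsto_add[OF tendsto_const])
  then show "(\<lambda>j. path_from B a s \<omega> (upper_grid j t)) \<longlonglongrightarrow> a + B t \<omega>"
    by (simp add: path_from_def max_absorb1 less_imp_le[OF gt])
qed

lemma measurable_path_from [measurable]:
  assumes "0 \<le> s"
  shows "path_from B a s \<in> M \<rightarrow>\<^sub>M path_space"
  unfolding path_from_def[abs_def] by (rule measurable_pathI) (use assms in simp)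

text \<open>The database enters the outputs only through the starting point \<open>f x\<close> of
  the path. Positivity of the times allows \<open>path_at\<close> to be replaced by evaluation of
  the continuous path.\<close>

lemma BM_eq_sample:
  assumes T: "time_functions T" and \<omega>: "\<omega> \<in> space M" and "1 \<le> n"
  shows "BM f T B x n \<omega> = sample T n (path_from B (f x) 0 \<omega>)"
  using \<open>1 \<le> n\<close>
proof (induction n rule: less_induct)
  case (less n)
  let ?w = "path_from B (f x) 0 \<omega>"
  have "(\<lambda>i\<in>{1..<n}. BM f T B x i \<omega>) = (\<lambda>i\<in>{1..<n}. sample T i ?w)"
    using less by (auto intro!: restrict_ext)
  then have "BM f T B x n \<omega> = f x + B (sample_time T n ?w) \<omega>"
    by (subst BM.simps) (simp add: sample_time_eq)
  moreover have "0 < sample_time T n ?w"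
    by (rule sample_time_pos[OF T less.prems])
  ultimately show ?case
    using path_at_path_from[OF \<omega>, of 0 "sample_time T n ?w" "f x"] by (simp add: sample_eq)
qed

text \<open>\<^const>\<open>indep_var\<close> needs two variables of the same type, hence the constant path \<open>B\<^sub>s\<close>.\<close>

lemma indep_increments_after:
  assumes s: "0 \<le> s"
  shows "indep_var path_space (\<lambda>\<omega> d. B s \<omega>) path_space (\<lambda>\<omega> d. B (max d s) \<omega> - B s \<omega>)"
proof -
  let ?U = "\<lambda>\<omega> d::real. B s \<omega>"
  let ?V = "\<lambda>\<omega> d. B (max d s) \<omega> - B s \<omega>"
  have U: "?U \<in> M \<rightarrow>\<^sub>M path_space"
    by (rule measurable_pathI) (use s in simp)
  have V: "?V \<in> M \<rightarrow>\<^sub>M path_space"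
    by (rule measurable_pathI) (use s in simp)
  have key: "prob (?U -` A \<inter> space M \<inter> (?V -` C \<inter> space M)) =
      prob (?U -` A \<inter> space M) * prob (?V -` C \<inter> space M)"
    if A: "A \<in> sets path_space" and C: "C \<in> prod_algebra UNIV (\<lambda>_. borel)" for A C
  proof -
    obtain J E where J: "finite J" and E: "\<And>j. j \<in> J \<Longrightarrow> E j \<in> sets borel"
      and C_eq: "C = prod_emb UNIV (\<lambda>_. borel) J (\<Pi>\<^sub>E j\<in>J. E j)"
      using prod_algebraE[OF C] by metis
    \<comment> \<open>The times that occur in the cylinder, together with \<open>s\<close>; as all
      of them are at least \<open>s\<close>, the sorted list starts with \<open>s\<close>.\<close>
    define S where "S = insert s ((\<lambda>d. max d s) ` J)"
    have S: "finite S" "S \<noteq> {}"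
      using J by (auto simp: S_def)
    define l where "l = sorted_list_of_set S"
    have l: "set l = S" "sorted l" "l \<noteq> []"
      using S by (auto simp: l_def)
    have l0: "l ! 0 = s"
    proof (rule antisym)
      have "s \<in> set l"
        using l(1) by (simp add: S_def)
      then obtain i where "i < length l" "l ! i = s"
        by (auto simp: in_set_conv_nth)
      then show "l ! 0 \<le> s"
        using sorted_nth_mono[OF l(2), of 0 i] by simp
      have "l ! 0 \<in> S"
        using l by (metis length_greater_0_conv nth_mem)
      then show "s \<le> l ! 0"
        by (auto simp: S_def)
    qed
    \<comment> \<open>The partition \<open>0, s, ...\<close> is prolonged by its last time, because
      independence of increments is stated for a monotone sequence on all naturals.\<close>
    define t where "t i = (case i of 0 \<Rightarrow> 0 | Suc k \<Rightarrow> l ! min k (length l - 1))" for i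
    have "mono t"
    proof (rule mono_iff_le_Suc[THEN iffD2], rule allI)
      fix i show "t i \<le> t (Suc i)"
      proof (cases i)
        case 0
        then show ?thesis using s l0 by (simp add: t_def)
      next
        case (Suc k)
        have "min (Suc k) (length l - 1) < length l"
          using l(3) by (cases l) auto
        then show ?thesis
          unfolding t_def Suc by (auto intro!: sorted_nth_mono[OF l(2)])
      qed
    qed
    have ind: "indep_vars (\<lambda>_. borel) (\<lambda>i \<omega>. B (t (Suc i)) \<omega> - B (t i) \<omega>) {..<length l}"
    proof -
      have "0 \<le> t 0"
        by (simp add: t_def)
      with brownian \<open>mono t\<close> show ?thesis
        unfolding standard_brownian_motion_def by blast
    qed
    have "\<exists>k<length l. l ! k = max d s" if "d \<in> J" for d
    proof -
      have "max d s \<in> set l"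
        using l(1) that by (simp add: S_def)
      then show ?thesis
        by (auto simp: in_set_conv_nth)
    qed
    then obtain k where k: "\<And>d. d \<in> J \<Longrightarrow> k d < length l \<and> l ! k d = max d s"
      by metis
    let ?P = "\<lambda>I \<omega>. \<lambda>i\<in>I. B (t (Suc i)) \<omega> - B (t i) \<omega>"
    \<comment> \<open>The increment with index \<open>0\<close> is \<open>B s\<close>; those from
      index \<open>1\<close> on sum up to the differences \<open>B (max d s) - B s\<close>.
      Splitting the index set separates the two groups.\<close>
    have "indep_var (PiM {0} (\<lambda>_. borel)) (?P {0}) (PiM {1..<length l} (\<lambda>_. borel)) (?P {1..<length l})"
      using l(3) by (intro indep_var_restrict[OF ind]) auto
    then have "indep_var path_space ((\<lambda>p d. p 0) \<circ> ?P {0})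
        (PiM J (\<lambda>_. borel)) ((\<lambda>p. \<lambda>d\<in>J. \<Sum>i\<in>{1..<Suc (k d)}. p i) \<circ> ?P {1..<length l})"
    proof (rule indep_var_compose)
      show "(\<lambda>p d. p 0) \<in> PiM {0} (\<lambda>_. borel :: 'v measure) \<rightarrow>\<^sub>M path_space"
        by (intro measurable_pathI measurable_component_singleton) simp
      show "(\<lambda>p. \<lambda>d\<in>J. \<Sum>i\<in>{1..<Suc (k d)}. p i) \<in>
          PiM {1..<length l} (\<lambda>_. borel :: 'v measure) \<rightarrow>\<^sub>M PiM J (\<lambda>_. borel)"
      proof (rule measurable_restrict, rule borel_measurable_sum)
        fix d i assume "d \<in> J" "i \<in> {1..<Suc (k d)}"
        then have "i \<in> {1..<length l}"
          using k[of d] by simp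
        then show "(\<lambda>p. p i) \<in> borel_measurable (PiM {1..<length l} (\<lambda>_. borel :: 'v measure))"
          by (rule measurable_component_singleton)
      qed
    qed
    then have iv: "indep_var path_space (\<lambda>\<omega> d. B (t 1) \<omega> - B (t 0) \<omega>)
        (PiM J (\<lambda>_. borel)) (\<lambda>\<omega>. \<lambda>d\<in>J. sum (?P {1..<length l} \<omega>) {1..<Suc (k d)})"
      by (simp add: comp_def del: sum.op_ivl_Suc)
    have "t 0 = 0" "t 1 = s"
      using l0 by (auto simp: t_def)
    then have eq1: "B (t 1) \<omega> - B (t 0) \<omega> = B s \<omega>" if "\<omega> \<in> space M" for \<omega>
      using brownian that by (simp add: standard_brownian_motion_def)
    have eq2: "(sum (?P {1..<length l} \<omega>) {1..<Suc (k d)}) = ?V \<omega> d" if d: "d \<in> J" for d \<omega>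
    proof -
      have "(sum (?P {1..<length l} \<omega>) {1..<Suc (k d)}) =
          (\<Sum>i\<in>{1..<Suc (k d)}. B (t (Suc i)) \<omega> - B (t i) \<omega>)"
        using k[OF d] by (intro sum.cong) auto
      also have "\<dots> = B (t (Suc (k d))) \<omega> - B (t 1) \<omega>"
        by (rule sum_Suc_diff') simp
      also have "t (Suc (k d)) = max d s"
      proof -
        have "min (k d) (length l - 1) = k d"
          using k[OF d] by linarith
        then show ?thesis
          using k[OF d] by (simp add: t_def)
      qed
      finally show ?thesis
        using \<open>t 1 = s\<close> by simp
    qed
    have PiE_sets: "Pi\<^sub>E J E \<in> sets (PiM J (\<lambda>_. borel))"
      using E J by (intro sets_PiM_I_finite) auto
    have increments: "(\<lambda>d\<in>J. sum (?P {1..<length l} \<omega>) {1..<Suc (k d)}) = (\<lambda>d\<in>J. ?V \<omega> d)" for \<omega>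
      by (rule restrict_ext) (rule eq2)
    note prod = indep_varD[OF iv A PiE_sets]
    have sets:
      "(\<lambda>\<omega>. (\<lambda>d. B (t 1) \<omega> - B (t 0) \<omega>, \<lambda>d\<in>J. sum (?P {1..<length l} \<omega>) {1..<Suc (k d)})) -`
        (A \<times> Pi\<^sub>E J E) \<inter> space M = {\<omega>\<in>space M. ?U \<omega> \<in> A \<and> (\<forall>d\<in>J. ?V \<omega> d \<in> E d)}"
      "(\<lambda>\<omega> d. B (t 1) \<omega> - B (t 0) \<omega>) -` A \<inter> space M = {\<omega>\<in>space M. ?U \<omega> \<in> A}"
      "(\<lambda>\<omega>. \<lambda>d\<in>J. sum (?P {1..<length l} \<omega>) {1..<Suc (k d)}) -` Pi\<^sub>E J E \<inter> space M =
        {\<omega>\<in>space M. \<forall>d\<in>J. ?V \<omega> d \<in> E d}"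
      unfolding increments using eq1 by (auto simp: PiE_iff)
    have "prob {\<omega>\<in>space M. ?U \<omega> \<in> A \<and> (\<forall>d\<in>J. ?V \<omega> d \<in> E d)} =
        prob {\<omega>\<in>space M. ?U \<omega> \<in> A} * prob {\<omega>\<in>space M. \<forall>d\<in>J. ?V \<omega> d \<in> E d}"
      using prod unfolding sets .
    moreover have "?V -` C \<inter> space M = {\<omega>\<in>space M. \<forall>d\<in>J. ?V \<omega> d \<in> E d}"
      unfolding C_eq by (auto simp: prod_emb_def PiE_iff)
    moreover have "?U -` A \<inter> space M = {\<omega>\<in>space M. ?U \<omega> \<in> A}"
      by auto
    moreover have "{\<omega>\<in>space M. ?U \<omega> \<in> A} \<inter> {\<omega>\<in>space M. \<forall>d\<in>J. ?V \<omega> d \<in> E d} =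
        {\<omega>\<in>space M. ?U \<omega> \<in> A \<and> (\<forall>d\<in>J. ?V \<omega> d \<in> E d)}"
      by auto
    ultimately show ?thesis
      by simp
  qed
  \<comment> \<open>\<open>indep_vars_finite\<close> asks that the whole space belong to each
    generator.\<close>
  have top_in_path_algebra: "UNIV \<in> prod_algebra UNIV (\<lambda>_::real. borel :: 'v measure)"
  proof -
    have "prod_emb UNIV (\<lambda>_. borel) {0} ({0::real} \<rightarrow>\<^sub>E (UNIV :: 'v set)) = UNIV"
      by (auto simp: prod_emb_def)
    then show ?thesis
      using prod_algebraI[of "{0}" UNIV "\<lambda>_. UNIV" "\<lambda>_::real. borel :: 'v measure"] by simp
  qed
  \<comment> \<open>Independence is checked on intersection-stable generators: all measurable sets
    for the first variable, finite-dimensional cylinders for the second.\<close>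
  let ?S = "case_bool path_space (path_space :: (real \<Rightarrow> 'v) measure)"
  let ?E = "case_bool (sets (path_space :: (real \<Rightarrow> 'v) measure)) (prod_algebra UNIV (\<lambda>_. borel))"
  have "indep_vars ?S (case_bool ?U ?V) UNIV \<longleftrightarrow>
      (\<forall>A\<in>(\<Pi> i\<in>UNIV. ?E i). prob (\<Inter>j\<in>UNIV. case_bool ?U ?V j -` A j \<inter> space M) =
        (\<Prod>j\<in>UNIV. prob (case_bool ?U ?V j -` A j \<inter> space M)))"
  proof (rule indep_vars_finite)
    show "sets (?S i) = sigma_sets (space (?S i)) (?E i)" for i
      by (cases i) (simp_all add: sets_PiM space_PiM sigma_sets_sigma_sets_eq)
    show "Int_stable (?E i)" for i
      by (cases i) (simp_all add: Int_stable_prod_algebra sets.Int_stable)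
    show "space (?S i) \<in> ?E i" for i
      using top_in_path_algebra sets.top[of "path_space :: (real \<Rightarrow> 'v) measure"]
      by (cases i) (simp_all add: space_PiM)
    show "?E i \<subseteq> Pow (space (?S i))" for i
      using prod_algebra_sets_into_space[of UNIV "\<lambda>_. borel"] by (cases i) (auto simp: space_PiM)
  qed (use U V in \<open>auto split: bool.split\<close>)
  then show ?thesis
    unfolding indep_var_def using key by (simp add: UNIV_bool Pi_iff Int_commute mult.commute)
qed

lemma distr_B:
  assumes "0 < s"
  shows "distr M borel (B s) =
    density lborel (\<lambda>y. ennreal (\<Prod>b\<in>Basis. normal_density 0 (sqrt s) (y \<bullet> b)))"
proof -
  have "distributed M lborel (\<lambda>\<omega>. B s \<omega> - B 0 \<omega>)
      (\<lambda>v. ennreal (\<Prod>b\<in>Basis. normal_density 0 (sqrt (s - 0)) (v \<bullet> b)))"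
    using brownian assms unfolding standard_brownian_motion_def by blast
  then have "distr M lborel (\<lambda>\<omega>. B s \<omega> - B 0 \<omega>) =
      density lborel (\<lambda>y. ennreal (\<Prod>b\<in>Basis. normal_density 0 (sqrt s) (y \<bullet> b)))"
    by (simp add: distributed_def)
  moreover have "distr M lborel (\<lambda>\<omega>. B s \<omega> - B 0 \<omega>) = distr M borel (B s)"
    using brownian by (intro distr_cong) (auto simp: standard_brownian_motion_def)
  ultimately show ?thesis
    by simp
qed

text \<open>By independence the joint law of the value at \<open>s\<close> and of the later
  increments is a product; the translation by \<open>a\<close> moves into the Gaussian density. The
  starting point is thus confined to that density.\<close>

lemma nn_integral_shifted_path:
  fixes a :: 'v
  assumes s: "0 < s" and K [measurable]: "K \<in> borel_measurable (borel \<Otimes>\<^sub>M path_space)"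
  shows "(\<integral>\<^sup>+\<omega>. K (a + B s \<omega>, \<lambda>d. B (max d s) \<omega> - B s \<omega>) \<partial>M) =
    (\<integral>\<^sup>+y. ennreal (\<Prod>b\<in>Basis. normal_density 0 (sqrt s) ((y - a) \<bullet> b)) *
      (\<integral>\<^sup>+v. K (y, v) \<partial>distr M path_space (\<lambda>\<omega> d. B (max d s) \<omega> - B s \<omega>)) \<partial>lborel)"
proof -
  let ?V = "\<lambda>\<omega> d. B (max d s) \<omega> - B s \<omega>"
  let ?\<nu> = "distr M path_space ?V"
  let ?U = "\<lambda>\<omega> d::real. B s \<omega>"
  let ?\<phi> = "\<lambda>y. ennreal (\<Prod>b\<in>Basis. normal_density 0 (sqrt s) (y \<bullet> b))"
  have iv: "indep_var path_space (\<lambda>\<omega> d. B s \<omega>) path_space ?V"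
    using s by (intro indep_increments_after) simp
  have [measurable]: "?U \<in> M \<rightarrow>\<^sub>M path_space" "?V \<in> M \<rightarrow>\<^sub>M path_space" "B s \<in> borel_measurable M"
    using iv s by (auto dest: indep_var_rv1 indep_var_rv2)
  interpret \<nu>: prob_space ?\<nu>
    by (rule prob_space_distr) simp
  have [measurable_cong]: "sets ?\<nu> = sets path_space"
    by simp
  have [measurable]: "(\<lambda>y. \<integral>\<^sup>+v. K (y, v) \<partial>?\<nu>) \<in> borel_measurable borel"
    by measurable
  have "(\<integral>\<^sup>+\<omega>. K (a + B s \<omega>, ?V \<omega>) \<partial>M) =
      (\<integral>\<^sup>+z. K (a + fst z 0, snd z) \<partial>distr M (path_space \<Otimes>\<^sub>M path_space) (\<lambda>\<omega>. (?U \<omega>, ?V \<omega>)))"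
    by (subst nn_integral_distr) auto
  also have "distr M (path_space \<Otimes>\<^sub>M path_space) (\<lambda>\<omega>. (?U \<omega>, ?V \<omega>)) = distr M path_space ?U \<Otimes>\<^sub>M ?\<nu>"
    using iv by (simp add: indep_var_distribution_eq)
  also have "(\<integral>\<^sup>+z. K (a + fst z 0, snd z) \<partial>(distr M path_space ?U \<Otimes>\<^sub>M ?\<nu>)) =
      (\<integral>\<^sup>+p. (\<integral>\<^sup>+v. K (a + p 0, v) \<partial>?\<nu>) \<partial>distr M path_space ?U)"
    by (subst \<nu>.nn_integral_fst[symmetric]) auto
  also have "\<dots> = (\<integral>\<^sup>+y. (\<integral>\<^sup>+v. K (a + y, v) \<partial>?\<nu>) \<partial>distr M borel (B s))"
    by (simp add: nn_integral_distr)
  also have "\<dots> = (\<integral>\<^sup>+y. ?\<phi> y * (\<integral>\<^sup>+v. K (a + y, v) \<partial>?\<nu>) \<partial>lborel)"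
    unfolding distr_B[OF s] by (subst nn_integral_density) auto
  also have "\<dots> = (\<integral>\<^sup>+y. ?\<phi> (y - a) * (\<integral>\<^sup>+v. K (y, v) \<partial>?\<nu>) \<partial>distr lborel borel ((+) a))"
    by (subst nn_integral_distr) auto
  finally show ?thesis
    by (simp add: lborel_distr_plus)
qed

text \<open>The law of the later increments is the same for both starting points, so only the
  density of the value at \<open>s\<close> has to be exchanged, which costs the Gaussian
  ratio.\<close>

lemma nn_integral_path_from_change_origin:
  assumes s: "0 < s" and F [measurable]: "F \<in> borel_measurable path_space"
  shows "(\<integral>\<^sup>+\<omega>. F (path_from B a s \<omega>) \<partial>M) =
    (\<integral>\<^sup>+\<omega>. F (path_from B a' s \<omega>) * ennreal (gaussian_ratio a a' s (a' + B s \<omega>)) \<partial>M)"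
proof -
  let ?V = "\<lambda>\<omega> d. B (max d s) \<omega> - B s \<omega>"
  let ?\<nu> = "distr M path_space ?V"
  let ?K = "\<lambda>z::'v \<times> (real \<Rightarrow> 'v). F (\<lambda>d. fst z + snd z d)"
  have "(\<lambda>(z::'v \<times> (real \<Rightarrow> 'v)) d. fst z + snd z d) \<in> borel \<Otimes>\<^sub>M path_space \<rightarrow>\<^sub>M path_space"
    by (intro measurable_pathI borel_measurable_add measurable_fst
        measurable_compose[OF measurable_snd measurable_component_singleton]) simp
  then have K [measurable]: "?K \<in> borel_measurable (borel \<Otimes>\<^sub>M path_space)"
    by (rule measurable_compose) (rule F)
  have V [measurable]: "?V \<in> M \<rightarrow>\<^sub>M path_space"
    using s indep_increments_after[of s] by (auto dest: indep_var_rv2)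
  have path: "path_from B c s \<omega> = (\<lambda>d. (c + B s \<omega>) + (B (max d s) \<omega> - B s \<omega>))" for c \<omega>
    by (simp add: path_from_def)
  have [measurable]: "gaussian_ratio a a' s \<in> borel_measurable borel"
    unfolding gaussian_ratio_def by measurable
  have "(\<integral>\<^sup>+\<omega>. F (path_from B a s \<omega>) \<partial>M) =
      (\<integral>\<^sup>+y. ennreal (\<Prod>b\<in>Basis. normal_density 0 (sqrt s) ((y - a) \<bullet> b)) *
        (\<integral>\<^sup>+v. ?K (y, v) \<partial>?\<nu>) \<partial>lborel)"
    unfolding path using nn_integral_shifted_path[OF s, of ?K a] by simp
  also have "\<dots> = (\<integral>\<^sup>+y. ennreal (\<Prod>b\<in>Basis. normal_density 0 (sqrt s) ((y - a') \<bullet> b)) *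
        (\<integral>\<^sup>+v. ?K (y, v) * ennreal (gaussian_ratio a a' s (fst (y, v))) \<partial>?\<nu>) \<partial>lborel)"
  proof (rule nn_integral_cong)
    fix y :: 'v
    have "(\<integral>\<^sup>+v. ?K (y, v) * ennreal (gaussian_ratio a a' s (fst (y, v))) \<partial>?\<nu>) =
        (\<integral>\<^sup>+v. ?K (y, v) \<partial>?\<nu>) * ennreal (gaussian_ratio a a' s y)"
      using measurable_compose[OF measurable_Pair1' K, of y] by (simp add: nn_integral_multc)
    then show "ennreal (\<Prod>b\<in>Basis. normal_density 0 (sqrt s) ((y - a) \<bullet> b)) * (\<integral>\<^sup>+v. ?K (y, v) \<partial>?\<nu>) =
        ennreal (\<Prod>b\<in>Basis. normal_density 0 (sqrt s) ((y - a') \<bullet> b)) *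
        (\<integral>\<^sup>+v. ?K (y, v) * ennreal (gaussian_ratio a a' s (fst (y, v))) \<partial>?\<nu>)"
      unfolding gaussian_ratio_density[OF s, of y a a']
      by (simp add: ennreal_mult less_imp_le[OF gaussian_ratio_pos] prod_nonneg mult_ac)
  qed
  also have "\<dots> = (\<integral>\<^sup>+\<omega>. F (path_from B a' s \<omega>) * ennreal (gaussian_ratio a a' s (a' + B s \<omega>)) \<partial>M)"
    unfolding path
    using nn_integral_shifted_path[OF s, of "\<lambda>z. ?K z * ennreal (gaussian_ratio a a' s (fst z))" a']
    by simp
  finally show ?thesis .
qed

end

subsection \<open>Change of the starting point at a random time\<close>

text \<open>Rounding goes down because the path from the rounded time on still contains all that
  happens from \<open>t\<close> on; this keeps the backward stopping property.\<close>

definition lower_grid :: "real \<Rightarrow> real \<Rightarrow> real" where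
  "lower_grid h t = h * of_int \<lfloor>t / h\<rfloor>"

lemma lower_grid_bounds:
  assumes "0 < h"
  shows "lower_grid h t \<le> t" "t - h \<le> lower_grid h t"
proof -
  have "h * of_int \<lfloor>t / h\<rfloor> \<le> h * (t / h)"
    using assms by (intro mult_left_mono) auto
  then show "lower_grid h t \<le> t"
    using assms by (simp add: lower_grid_def)
  have "h * (t / h - 1) \<le> h * of_int \<lfloor>t / h\<rfloor>"
    using assms by (intro mult_left_mono) linarith+
  then show "t - h \<le> lower_grid h t"
    using assms by (simp add: lower_grid_def right_diff_distrib)
qed

text \<open>The cells are disjoint, and the one containing \<open>t\<close> has left end
  \<open>lower_grid h t\<close>. Counting from \<open>Suc m\<close> omits the cell at
  \<open>0\<close>, so that all grid times are positive; this is the reason for the case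
  \<open>h \<le> t\<close>.\<close>

lemma suminf_grid_cells:
  fixes c :: "real \<Rightarrow> ennreal"
  assumes h: "0 < h"
  shows "(\<Sum>m. c (h * real (Suc m)) * indicator {h * real (Suc m)..<h * real (Suc m) + h} t) =
    (if h \<le> t then c (lower_grid h t) else 0)"
proof (cases "h \<le> t")
  case False
  have "t \<notin> {h * real (Suc m)..<h * real (Suc m) + h}" for m
  proof -
    have "h * 1 \<le> h * real (Suc m)"
      using h by (intro mult_left_mono) auto
    then show ?thesis
      using False by auto
  qed
  then show ?thesis
    using False by simp
next
  case True
  have "disjoint_family (\<lambda>m. {h * real (Suc m)..<h * real (Suc m) + h})"
    unfolding disjoint_family_on_def
  proof safe
    fix m m' x assume "m \<noteq> m'"
      and *: "x \<in> {h * real (Suc m)..<h * real (Suc m) + h}"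
        "x \<in> {h * real (Suc m')..<h * real (Suc m') + h}"
    have "h * real m < h * (real m' + 1)" "h * real m' < h * (real m + 1)"
      using * by (auto simp: algebra_simps)
    then have "real m < real m' + 1" "real m' < real m + 1"
      using h by auto
    then show "x \<in> {}"
      using \<open>m \<noteq> m'\<close> by linarith
  qed
  moreover have "1 \<le> \<lfloor>t / h\<rfloor>"
    using True h by simp
  then obtain m where m: "\<lfloor>t / h\<rfloor> = int (Suc m)"
    by (metis Suc_le_D of_nat_1 of_nat_le_iff One_nat_def zero_le_imp_eq_int order_trans zero_le_one)
  then have "h * real (Suc m) = lower_grid h t"
    by (simp add: lower_grid_def)
  moreover have "t < lower_grid h t + h"
  proof -
    have "t / h < of_int \<lfloor>t / h\<rfloor> + 1"
      by linarith
    then have "h * (t / h) < h * (of_int \<lfloor>t / h\<rfloor> + 1)"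
      using h by (intro mult_strict_left_mono)
    then show ?thesis
      using h by (simp add: lower_grid_def algebra_simps)
  qed
  ultimately show ?thesis
    using suminf_cmult_indicator[of "\<lambda>m. {h * real (Suc m)..<h * real (Suc m) + h}" t m
        "\<lambda>m. c (h * real (Suc m))"] True lower_grid_bounds(1)[OF h, of t]
    by simp
qed

text \<open>Provides the constant majorant for dominated convergence: the subtracted square is
  dropped, and \<open>\<epsilon> / 2 \<le> s\<close> bounds the denominator from below.\<close>

lemma gaussian_ratio_bound:
  assumes "norm y \<le> r" and "0 < \<epsilon>" and "\<epsilon> / 2 \<le> s"
  shows "gaussian_ratio a a' s y \<le> exp ((r + norm a')\<^sup>2 / \<epsilon>)"
proof -
  have "norm (y - a') \<le> r + norm a'"
    using norm_triangle_ineq4[of y a'] assms(1) by simp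
  then have "(norm (y - a'))\<^sup>2 \<le> (r + norm a')\<^sup>2"
    by (intro power_mono) auto
  moreover have "0 \<le> (norm (y - a))\<^sup>2"
    by simp
  ultimately have "(norm (y - a'))\<^sup>2 - (norm (y - a))\<^sup>2 \<le> (r + norm a')\<^sup>2"
    by linarith
  then have "((norm (y - a'))\<^sup>2 - (norm (y - a))\<^sup>2) / (2 * s) \<le> (r + norm a')\<^sup>2 / \<epsilon>"
    using assms by (intro frac_le) auto
  then show ?thesis
    by (simp add: gaussian_ratio_def)
qed

context brownian_motion
begin

text \<open>On each cell the random time is replaced by the left end \<open>s m\<close>, a fixed
  time, where the change of origin is known. It applies because past and cell event are determined
  by the path from \<open>s m\<close> on. The ratio is still taken at the grid time.\<close>

lemma nn_integral_grid_change_origin: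
  fixes g :: "real \<times> 'v \<Rightarrow> ennreal"
  assumes T: "time_functions T" and n: "1 \<le> n" and h: "0 < h"
    and H [measurable]: "H \<in> borel_measurable (PiM {1..<n} (\<lambda>_. borel))"
    and g [measurable]: "g \<in> borel_measurable (borel \<Otimes>\<^sub>M borel)"
  defines "past \<equiv> \<lambda>w. \<lambda>i\<in>{1..<n}. sample T i w" and "s \<equiv> \<lambda>m. h * real (Suc m)"
  shows "(\<integral>\<^sup>+\<omega>. (\<Sum>m. H (past (path_from B a 0 \<omega>)) * g (s m, a + B (s m) \<omega>) *
      indicator {s m..<s m + h} (sample_time T n (path_from B a 0 \<omega>))) \<partial>M) =
    (\<integral>\<^sup>+\<omega>. (\<Sum>m. H (past (path_from B a' 0 \<omega>)) * (g (s m, a' + B (s m) \<omega>) *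
      ennreal (gaussian_ratio a a' (s m) (a' + B (s m) \<omega>))) *
      indicator {s m..<s m + h} (sample_time T n (path_from B a' 0 \<omega>))) \<partial>M)"
proof -
  have s: "0 < s m" for m
    using h by (simp add: s_def)
  have [measurable]: "past \<in> path_space \<rightarrow>\<^sub>M PiM {1..<n} (\<lambda>_. borel)"
    unfolding past_def by (rule measurable_sample_restrict[OF T]) simp
  have [measurable]: "sample_time T n \<in> borel_measurable path_space"
    by (rule measurable_sample_time[OF T n])
  have [measurable]: "B (s m) \<in> borel_measurable M" for m
    using s[of m] by simp
  have [measurable]: "path_from B c 0 \<in> M \<rightarrow>\<^sub>M path_space" for c
    by simp
  have [measurable]: "gaussian_ratio a a' t \<in> borel_measurable borel" for t
    unfolding gaussian_ratio_def by measurable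
  \<comment> \<open>\<open>F m\<close> is meant for paths frozen before \<open>s m\<close>;
    \<open>F_eq\<close> shows that its value there can be expressed by the past and the time of the
    full path.\<close>
  define F where "F m w = H (past w) * g (s m, w (s m)) * indicator {s m..<s m + h} (sample_time T n w)"
    for m w
  have F [measurable]: "F m \<in> borel_measurable path_space" for m
    unfolding F_def by measurable
  have F_eq: "F m (path_from B c (s m) \<omega>) = H (past (path_from B c 0 \<omega>)) * g (s m, c + B (s m) \<omega>) *
      indicator {s m..<s m + h} (sample_time T n (path_from B c 0 \<omega>))"
    if \<omega>: "\<omega> \<in> space M" for c m \<omega>
  proof -
    let ?w = "path_from B c (s m) \<omega>" and ?w' = "path_from B c 0 \<omega>"
    have agree: "path_at t ?w = path_at t ?w'" if "s m \<le> t" for t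
      using path_at_path_from[OF \<omega>, of "s m" t c] path_at_path_from[OF \<omega>, of 0 t c] that s[of m]
      by simp
    have at_s: "?w (s m) = c + B (s m) \<omega>"
      by (simp add: path_from_def)
    show ?thesis
    proof (cases "s m \<le> sample_time T n ?w")
      case True
      have "past ?w' = past ?w"
        unfolding past_def using sample_cong[OF T agree True]
        by (intro restrict_ext) simp
      moreover have "sample_time T n ?w' = sample_time T n ?w"
        by (rule sample_time_cong[OF T agree True n])
      ultimately show ?thesis
        by (simp add: F_def at_s)
    next
      case False
      then have "\<not> s m \<le> sample_time T n ?w'"
        using sample_time_cong[OF T agree[symmetric] _ n] by metis
      with False show ?thesis
        by (simp add: F_def)
    qed
  qed
  have "(\<integral>\<^sup>+\<omega>. (\<Sum>m. H (past (path_from B a 0 \<omega>)) * g (s m, a + B (s m) \<omega>) *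
      indicator {s m..<s m + h} (sample_time T n (path_from B a 0 \<omega>))) \<partial>M) =
      (\<Sum>m. \<integral>\<^sup>+\<omega>. H (past (path_from B a 0 \<omega>)) * g (s m, a + B (s m) \<omega>) *
      indicator {s m..<s m + h} (sample_time T n (path_from B a 0 \<omega>)) \<partial>M)"
    by (rule nn_integral_suminf) measurable
  also have "\<dots> = (\<Sum>m. \<integral>\<^sup>+\<omega>. F m (path_from B a (s m) \<omega>) \<partial>M)"
    by (intro suminf_cong nn_integral_cong) (simp add: F_eq)
  also have "\<dots> = (\<Sum>m. \<integral>\<^sup>+\<omega>. F m (path_from B a' (s m) \<omega>) *
      ennreal (gaussian_ratio a a' (s m) (a' + B (s m) \<omega>)) \<partial>M)"
    by (intro suminf_cong nn_integral_path_from_change_origin s F)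
  also have "\<dots> = (\<Sum>m. \<integral>\<^sup>+\<omega>. H (past (path_from B a' 0 \<omega>)) * (g (s m, a' + B (s m) \<omega>) *
      ennreal (gaussian_ratio a a' (s m) (a' + B (s m) \<omega>))) *
      indicator {s m..<s m + h} (sample_time T n (path_from B a' 0 \<omega>)) \<partial>M)"
    by (intro suminf_cong nn_integral_cong) (simp add: F_eq mult_ac)
  also have "\<dots> = (\<integral>\<^sup>+\<omega>. (\<Sum>m. H (past (path_from B a' 0 \<omega>)) * (g (s m, a' + B (s m) \<omega>) *
      ennreal (gaussian_ratio a a' (s m) (a' + B (s m) \<omega>))) *
      indicator {s m..<s m + h} (sample_time T n (path_from B a' 0 \<omega>))) \<partial>M)"
    by (rule nn_integral_suminf[symmetric]) measurable
  finally show ?thesis .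
qed

text \<open>As the mesh tends to \<open>0\<close>, the rounded times tend to the random time, and
  continuity gives pointwise convergence. On \<open>A\<close> the time is at least
  \<open>\<epsilon>\<close> and the mesh is at most \<open>\<epsilon> / 2\<close>, so every rounded
  time stays in the range where \<open>K\<close> dominates.\<close>

lemma nn_integral_grid_tendsto:
  fixes g :: "real \<times> 'v \<Rightarrow> real"
  assumes T: "time_functions T" and n: "1 \<le> n" and \<epsilon>: "0 < \<epsilon>"
    and A [measurable]: "A \<in> sets (PiM {1..<n} (\<lambda>_. borel))" and A_time: "\<And>\<beta>. \<beta> \<in> A \<Longrightarrow> \<epsilon> \<le> T n \<beta>"
    and g [measurable]: "g \<in> borel_measurable (borel \<Otimes>\<^sub>M borel)"
    and g_cont: "continuous_on ({0<..} \<times> UNIV) g"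
    and g_bound: "\<And>s y. \<epsilon> / 2 \<le> s \<Longrightarrow> g (s, y) \<le> K"
  defines "past \<equiv> \<lambda>w. \<lambda>i\<in>{1..<n}. sample T i w"
    and "h \<equiv> \<lambda>k. \<epsilon> / (2 * real (Suc k))" and "s \<equiv> \<lambda>k m. \<epsilon> / (2 * real (Suc k)) * real (Suc m)"
  shows "(\<lambda>k. \<integral>\<^sup>+\<omega>. (\<Sum>m. indicator A (past (path_from B a 0 \<omega>)) * ennreal (g (s k m, a + B (s k m) \<omega>)) *
      indicator {s k m..<s k m + h k} (sample_time T n (path_from B a 0 \<omega>))) \<partial>M) \<longlonglongrightarrow>
    (\<integral>\<^sup>+\<omega>. indicator A (past (path_from B a 0 \<omega>)) *
      ennreal (g (sample_time T n (path_from B a 0 \<omega>), sample T n (path_from B a 0 \<omega>))) \<partial>M)"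
proof (rule nn_integral_dominated_convergence[where w="\<lambda>_. ennreal K"])
  have h: "0 < h k" for k
    using \<epsilon> by (simp add: h_def)
  have s_eq: "s k m = h k * real (Suc m)" for k m
    by (simp add: s_def h_def)
  have s: "0 < s k m" for k m
    using h by (simp add: s_eq)
  have [measurable]: "past \<in> path_space \<rightarrow>\<^sub>M PiM {1..<n} (\<lambda>_. borel)"
    unfolding past_def by (rule measurable_sample_restrict[OF T]) simp
  have [measurable]: "sample_time T n \<in> borel_measurable path_space"
    by (rule measurable_sample_time[OF T n])
  have [measurable]: "sample T n \<in> borel_measurable path_space"
    by (rule measurable_sample[OF T n])
  have [measurable]: "B (s k m) \<in> borel_measurable M" for k m
    using s[of k m] by simp
  have [measurable]: "path_from B c 0 \<in> M \<rightarrow>\<^sub>M path_space" for c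
    by simp
  show "(\<lambda>\<omega>. \<Sum>m. indicator A (past (path_from B a 0 \<omega>)) * ennreal (g (s k m, a + B (s k m) \<omega>)) *
      indicator {s k m..<s k m + h k} (sample_time T n (path_from B a 0 \<omega>))) \<in> borel_measurable M" for k
    by measurable
  show "(\<lambda>\<omega>. indicator A (past (path_from B a 0 \<omega>)) *
      ennreal (g (sample_time T n (path_from B a 0 \<omega>), sample T n (path_from B a 0 \<omega>)))) \<in> borel_measurable M"
    by measurable
  \<comment> \<open>Only the cell containing the time contributes, so the series is a single value
    at the rounded time.\<close>
  have sum_eq: "(\<Sum>m. indicator A (past (path_from B a 0 \<omega>)) * ennreal (g (s k m, a + B (s k m) \<omega>)) *
      indicator {s k m..<s k m + h k} (sample_time T n (path_from B a 0 \<omega>))) =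
      (let \<tau> = sample_time T n (path_from B a 0 \<omega>) in
        if h k \<le> \<tau> then indicator A (past (path_from B a 0 \<omega>)) *
          ennreal (g (lower_grid (h k) \<tau>, a + B (lower_grid (h k) \<tau>) \<omega>)) else 0)" for k \<omega>
    using suminf_grid_cells[OF h[of k], of "\<lambda>t. indicator A (past (path_from B a 0 \<omega>)) *
      ennreal (g (t, a + B t \<omega>))" "sample_time T n (path_from B a 0 \<omega>)"]
    by (simp add: s_eq Let_def)
  have h_le: "h k \<le> \<epsilon> / 2" for k
    using \<epsilon> unfolding h_def by (intro divide_left_mono) auto
  have half: "\<epsilon> / 2 \<le> lower_grid (h k) t" if "\<epsilon> \<le> t" for k t
    using lower_grid_bounds(2)[OF h[of k], of t] h_le[of k] that by linarith
  have past_time: "\<epsilon> \<le> sample_time T n w" if "past w \<in> A" for w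
    using A_time[OF that] by (simp add: sample_time_eq past_def)
  show "AE \<omega> in M. (\<Sum>m. indicator A (past (path_from B a 0 \<omega>)) * ennreal (g (s k m, a + B (s k m) \<omega>)) *
      indicator {s k m..<s k m + h k} (sample_time T n (path_from B a 0 \<omega>))) \<le> ennreal K" for k
    unfolding sum_eq Let_def
    by (intro AE_I2) (auto simp: indicator_def intro!: ennreal_leI g_bound half dest: past_time)
  show "AE \<omega> in M. (\<lambda>k. \<Sum>m. indicator A (past (path_from B a 0 \<omega>)) * ennreal (g (s k m, a + B (s k m) \<omega>)) *
      indicator {s k m..<s k m + h k} (sample_time T n (path_from B a 0 \<omega>))) \<longlonglongrightarrow>
      indicator A (past (path_from B a 0 \<omega>)) *
      ennreal (g (sample_time T n (path_from B a 0 \<omega>), sample T n (path_from B a 0 \<omega>)))"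
  proof (rule AE_I2)
    fix \<omega> assume \<omega>: "\<omega> \<in> space M"
    let ?w = "path_from B a 0 \<omega>"
    let ?\<tau> = "sample_time T n ?w"
    show "(\<lambda>k. \<Sum>m. indicator A (past ?w) * ennreal (g (s k m, a + B (s k m) \<omega>)) *
        indicator {s k m..<s k m + h k} ?\<tau>) \<longlonglongrightarrow>
        indicator A (past ?w) * ennreal (g (?\<tau>, sample T n ?w))"
    proof (cases "past ?w \<in> A")
      case False
      then show ?thesis
        by simp
    next
      case True
      then have \<tau>: "\<epsilon> \<le> ?\<tau>" "0 < ?\<tau>"
        using past_time[OF True] \<epsilon> by auto
      have h_lim: "h \<longlonglongrightarrow> 0"
        using tendsto_mult[OF tendsto_const[of "\<epsilon> / 2"] LIMSEQ_inverse_real_of_nat]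
        by (simp add: h_def inverse_eq_divide)
      have grid_lim: "(\<lambda>k. lower_grid (h k) ?\<tau>) \<longlonglongrightarrow> ?\<tau>"
      proof (rule tendsto_sandwich[where f="\<lambda>k. ?\<tau> - h k" and h="\<lambda>_. ?\<tau>"])
        show "(\<lambda>k. ?\<tau> - h k) \<longlonglongrightarrow> ?\<tau>"
          using tendsto_diff[OF tendsto_const h_lim, of ?\<tau>] by simp
        show "\<forall>\<^sub>F k in sequentially. ?\<tau> - h k \<le> lower_grid (h k) ?\<tau>"
          by (intro always_eventually allI lower_grid_bounds h)
        show "\<forall>\<^sub>F k in sequentially. lower_grid (h k) ?\<tau> \<le> ?\<tau>"
          by (intro always_eventually allI lower_grid_bounds h)
      qed simp
      have grid_pos: "0 < lower_grid (h k) ?\<tau>" for k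
        using half[OF \<tau>(1), of k] \<epsilon> by linarith
      have "(\<lambda>k. B (lower_grid (h k) ?\<tau>) \<omega>) \<longlonglongrightarrow> B ?\<tau> \<omega>"
      proof (rule continuous_on_tendsto_compose[where f="\<lambda>t. B t \<omega>"])
        show "continuous_on {0..} (\<lambda>t. B t \<omega>)"
          using brownian \<omega> by (simp add: standard_brownian_motion_def)
        show "\<forall>\<^sub>F k in sequentially. lower_grid (h k) ?\<tau> \<in> {0..}"
          by (simp add: less_imp_le[OF grid_pos])
      qed (use \<tau> grid_lim in auto)
      then have "(\<lambda>k. (lower_grid (h k) ?\<tau>, a + B (lower_grid (h k) ?\<tau>) \<omega>)) \<longlonglongrightarrow> (?\<tau>, a + B ?\<tau> \<omega>)"
        by (intro tendsto_Pair grid_lim tendsto_add tendsto_const)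
      then have "(\<lambda>k. g (lower_grid (h k) ?\<tau>, a + B (lower_grid (h k) ?\<tau>) \<omega>)) \<longlonglongrightarrow> g (?\<tau>, a + B ?\<tau> \<omega>)"
        by (rule continuous_on_tendsto_compose[OF g_cont]) (use \<tau> grid_pos in auto)
      then have "(\<lambda>k. ennreal (g (lower_grid (h k) ?\<tau>, a + B (lower_grid (h k) ?\<tau>) \<omega>))) \<longlonglongrightarrow>
          ennreal (g (?\<tau>, a + B ?\<tau> \<omega>))"
        by (rule tendsto_ennrealI)
      moreover have "h k \<le> ?\<tau>" for k
        using h_le[of k] \<tau> \<epsilon> by linarith
      moreover have "sample T n ?w = a + B ?\<tau> \<omega>"
        using path_at_path_from[OF \<omega>, of 0 ?\<tau> a] \<tau> by (simp add: sample_eq)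
      ultimately show ?thesis
        unfolding sum_eq Let_def using True by simp
    qed
  qed
qed (auto simp: emeasure_space_1)

end

text \<open>Scaled distances to the complement of \<open>U\<close> within a growing ball, truncated
  at \<open>1\<close>. The bounded support will keep the Gaussian ratio bounded, and monotonicity
  serves the later passage to the limit.\<close>

lemma open_indicator_approx:
  fixes U :: "'v::euclidean_space set"
  assumes U: "open U"
  obtains g :: "nat \<Rightarrow> 'v \<Rightarrow> real" where
    "\<And>j. continuous_on UNIV (g j)" "\<And>j y. 0 \<le> g j y" "\<And>j y. g j y \<le> 1"
    "\<And>j y. real j < norm y \<Longrightarrow> g j y = 0" "\<And>y. incseq (\<lambda>j. g j y)"
    "\<And>y. \<forall>\<^sub>F j in sequentially. g j y = indicator U y"
proof
  define S where "S j = - (U \<inter> ball 0 (real j))" for j :: nat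
  define g where "g j y = min 1 (real j * infdist y (S j))" for j y
  \<comment> \<open>\<open>infdist\<close> is \<open>0\<close> for the empty set, so monotonicity
    and positivity need \<open>S j\<close> to be nonempty; the ball guarantees this even for
    \<open>U = UNIV\<close>.\<close>
  have S_ne: "S j \<noteq> {}" for j
  proof -
    obtain y :: 'v where "norm y = real j"
      using vector_choose_size[of "real j"] by auto
    then have "y \<in> S j"
      by (simp add: S_def)
    then show ?thesis
      by blast
  qed
  have S_closed: "closed (S j)" for j
    using U by (auto simp: S_def)
  show "continuous_on UNIV (g j)" for j
    unfolding g_def by (intro continuous_intros)
  show "0 \<le> g j y" "g j y \<le> 1" for j y
    by (auto simp: g_def infdist_nonneg)
  show "g j y = 0" if "real j < norm y" for j y
    using that by (simp add: g_def S_def)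
  show inc: "incseq (\<lambda>j. g j y)" for y
  proof (rule incseq_SucI)
    fix j
    have "infdist y (S j) \<le> infdist y (S (Suc j))"
      by (rule infdist_mono[OF _ S_ne]) (auto simp: S_def)
    then have "real j * infdist y (S j) \<le> real (Suc j) * infdist y (S (Suc j))"
      by (intro mult_mono) (auto simp: infdist_nonneg)
    then show "g j y \<le> g (Suc j) y"
      unfolding g_def by (rule min.mono[OF order_refl])
  qed
  show "\<forall>\<^sub>F j in sequentially. g j y = indicator U y" for y
  proof (cases "y \<in> U")
    case False
    then show ?thesis
      by (simp add: g_def S_def)
  next
    case True
    obtain j where j: "norm y < real j"
      using reals_Archimedean2 by blast
    then have pos: "0 < infdist y (S j)"
      using True by (intro infdist_pos_not_in_closed[OF S_closed S_ne]) (simp add: S_def)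
    obtain k where k: "1 / infdist y (S j) < real k"
      using reals_Archimedean2 by blast
    have "g i y = 1" if "max j k \<le> i" for i
    proof -
      have "1 \<le> real k * infdist y (S j)"
        using k pos by (simp add: pos_divide_less_eq less_imp_le)
      also have "\<dots> \<le> real i * infdist y (S i)"
      proof (intro mult_mono)
        show "infdist y (S j) \<le> infdist y (S i)"
          using that by (intro infdist_mono[OF _ S_ne]) (auto simp: S_def)
      qed (use that in \<open>auto simp: infdist_nonneg\<close>)
      finally show ?thesis
        by (simp add: g_def)
    qed
    then show ?thesis
      using True by (auto simp: eventually_sequentially intro!: exI[of _ "max j k"])
  qed
qed

context brownian_motion
begin

text \<open>Both integrals are limits of grid integrals, with test functions \<open>g\<close> and
  \<open>g\<close> times the ratio, and the grid integrals agree for each mesh. Continuity of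
  \<open>g\<close> gives the limits, its bounded support the bound on the ratio.\<close>

lemma nn_integral_sample_change_origin_cont:
  fixes g :: "'v \<Rightarrow> real"
  assumes T: "time_functions T" and n: "1 \<le> n" and \<epsilon>: "0 < \<epsilon>"
    and A: "A \<in> sets (PiM {1..<n} (\<lambda>_. borel))" and A_time: "\<And>\<beta>. \<beta> \<in> A \<Longrightarrow> \<epsilon> \<le> T n \<beta>"
    and g_cont: "continuous_on UNIV g" and g: "\<And>y. 0 \<le> g y" "\<And>y. g y \<le> 1"
    and g_supp: "\<And>y. r < norm y \<Longrightarrow> g y = 0"
  defines "past \<equiv> \<lambda>w. \<lambda>i\<in>{1..<n}. sample T i w"
  shows "(\<integral>\<^sup>+\<omega>. indicator A (past (path_from B a 0 \<omega>)) * ennreal (g (sample T n (path_from B a 0 \<omega>))) \<partial>M) =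
    (\<integral>\<^sup>+\<omega>. indicator A (past (path_from B a' 0 \<omega>)) * ennreal (g (sample T n (path_from B a' 0 \<omega>)) *
      gaussian_ratio a a' (sample_time T n (path_from B a' 0 \<omega>)) (sample T n (path_from B a' 0 \<omega>))) \<partial>M)"
proof -
  have [measurable]: "g \<in> borel_measurable borel"
    using g_cont by (rule borel_measurable_continuous_onI)
  let ?g = "\<lambda>z::real \<times> 'v. g (snd z)"
  let ?g' = "\<lambda>z::real \<times> 'v. g (snd z) * gaussian_ratio a a' (fst z) (snd z)"
  have [measurable]: "(\<lambda>z. gaussian_ratio a a' (fst z) (snd z)) \<in> borel_measurable (borel \<Otimes>\<^sub>M borel)"
    unfolding gaussian_ratio_def by measurable
  have cont: "continuous_on S (\<lambda>z::real \<times> 'v. g (snd z))" for S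
    by (rule continuous_on_compose2[OF g_cont]) (auto intro!: continuous_intros)
  have lim: "(\<lambda>k. \<integral>\<^sup>+\<omega>. (\<Sum>m. indicator A (past (path_from B a 0 \<omega>)) *
      ennreal (?g (\<epsilon> / (2 * real (Suc k)) * real (Suc m), a + B (\<epsilon> / (2 * real (Suc k)) * real (Suc m)) \<omega>)) *
      indicator {\<epsilon> / (2 * real (Suc k)) * real (Suc m)..<\<epsilon> / (2 * real (Suc k)) * real (Suc m) +
        \<epsilon> / (2 * real (Suc k))} (sample_time T n (path_from B a 0 \<omega>))) \<partial>M) \<longlonglongrightarrow>
    (\<integral>\<^sup>+\<omega>. indicator A (past (path_from B a 0 \<omega>)) *
      ennreal (?g (sample_time T n (path_from B a 0 \<omega>), sample T n (path_from B a 0 \<omega>))) \<partial>M)"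
    unfolding past_def
    by (rule nn_integral_grid_tendsto[OF T n \<epsilon> A A_time, where K=1]) (use cont g in auto)
  have lim': "(\<lambda>k. \<integral>\<^sup>+\<omega>. (\<Sum>m. indicator A (past (path_from B a' 0 \<omega>)) *
      ennreal (?g' (\<epsilon> / (2 * real (Suc k)) * real (Suc m), a' + B (\<epsilon> / (2 * real (Suc k)) * real (Suc m)) \<omega>)) *
      indicator {\<epsilon> / (2 * real (Suc k)) * real (Suc m)..<\<epsilon> / (2 * real (Suc k)) * real (Suc m) +
        \<epsilon> / (2 * real (Suc k))} (sample_time T n (path_from B a' 0 \<omega>))) \<partial>M) \<longlonglongrightarrow>
    (\<integral>\<^sup>+\<omega>. indicator A (past (path_from B a' 0 \<omega>)) *
      ennreal (?g' (sample_time T n (path_from B a' 0 \<omega>), sample T n (path_from B a' 0 \<omega>))) \<partial>M)"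
    unfolding past_def
  proof (rule nn_integral_grid_tendsto[OF T n \<epsilon> A A_time, where K="exp ((r + norm a')\<^sup>2 / \<epsilon>)"])
    show "continuous_on ({0<..} \<times> UNIV) ?g'"
      unfolding gaussian_ratio_def by (intro continuous_intros cont) auto
    show "?g' (t, y) \<le> exp ((r + norm a')\<^sup>2 / \<epsilon>)" if t: "\<epsilon> / 2 \<le> t" for t y
    proof (cases "norm y \<le> r")
      case True
      have "g y * gaussian_ratio a a' t y \<le> 1 * gaussian_ratio a a' t y"
        using g by (intro mult_right_mono less_imp_le[OF gaussian_ratio_pos])
      also have "\<dots> \<le> exp ((r + norm a')\<^sup>2 / \<epsilon>)"
        using gaussian_ratio_bound[OF True \<epsilon> t] by simp
      finally show ?thesis
        by simp
    qed (simp add: g_supp)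
  qed (auto simp: past_def)
  have "(\<integral>\<^sup>+\<omega>. (\<Sum>m. indicator A (past (path_from B a 0 \<omega>)) *
      ennreal (?g (h * real (Suc m), a + B (h * real (Suc m)) \<omega>)) *
      indicator {h * real (Suc m)..<h * real (Suc m) + h} (sample_time T n (path_from B a 0 \<omega>))) \<partial>M) =
    (\<integral>\<^sup>+\<omega>. (\<Sum>m. indicator A (past (path_from B a' 0 \<omega>)) *
      ennreal (?g' (h * real (Suc m), a' + B (h * real (Suc m)) \<omega>)) *
      indicator {h * real (Suc m)..<h * real (Suc m) + h} (sample_time T n (path_from B a' 0 \<omega>))) \<partial>M)"
    if "0 < h" for h
  proof -
    have "ennreal (?g' (t, y)) = ennreal (?g (t, y)) * ennreal (gaussian_ratio a a' t y)" for t y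
      using g by (simp add: ennreal_mult less_imp_le[OF gaussian_ratio_pos])
    then show ?thesis
      using nn_integral_grid_change_origin[OF T n that, of "indicator A" "\<lambda>z. ennreal (?g z)" a a'] A
      by (simp add: past_def)
  qed
  note eq = this
  have "0 < \<epsilon> / (2 * real (Suc k))" for k
    using \<epsilon> by simp
  from LIMSEQ_unique[OF lim[unfolded eq[OF this]] lim'] show ?thesis
    by simp
qed

text \<open>Monotone convergence removes the restrictions to bounded outputs and to times bounded
  away from \<open>0\<close>, and replaces continuous test functions by indicators of open
  sets.\<close>

lemma nn_integral_sample_change_origin_open:
  assumes T: "time_functions T" and n: "1 \<le> n"
    and A [measurable]: "A \<in> sets (PiM {1..<n} (\<lambda>_. borel))" and U: "open U"
  defines "past \<equiv> \<lambda>w. \<lambda>i\<in>{1..<n}. sample T i w"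
  shows "(\<integral>\<^sup>+\<omega>. indicator A (past (path_from B a 0 \<omega>)) * indicator U (sample T n (path_from B a 0 \<omega>)) \<partial>M) =
    (\<integral>\<^sup>+\<omega>. indicator A (past (path_from B a' 0 \<omega>)) * indicator U (sample T n (path_from B a' 0 \<omega>)) *
      ennreal (gaussian_ratio a a' (sample_time T n (path_from B a' 0 \<omega>)) (sample T n (path_from B a' 0 \<omega>))) \<partial>M)"
proof -
  obtain g :: "nat \<Rightarrow> 'v \<Rightarrow> real" where g_cont: "\<And>j. continuous_on UNIV (g j)"
    and g: "\<And>j y. 0 \<le> g j y" "\<And>j y. g j y \<le> 1"
    and g_supp: "\<And>j y. real j < norm y \<Longrightarrow> g j y = 0" and g_inc: "\<And>y. incseq (\<lambda>j. g j y)"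
    and g_lim: "\<And>y. \<forall>\<^sub>F j in sequentially. g j y = indicator U y"
    using open_indicator_approx[OF U] by metis
  have [measurable]: "g j \<in> borel_measurable borel" for j
    using g_cont by (rule borel_measurable_continuous_onI)
  have Tn [measurable]: "T n \<in> borel_measurable (PiM {1..<n} (\<lambda>_. borel))"
    using T n by (simp add: time_functions_def)
  \<comment> \<open>The truncations exhaust \<open>A\<close>, because the time functions are
    strictly positive.\<close>
  define A' where "A' j = {\<beta>\<in>A. 1 / real (Suc j) \<le> T n \<beta>}" for j :: nat
  have A'_meas [measurable]: "A' j \<in> sets (PiM {1..<n} (\<lambda>_. borel))" for j
  proof -
    have "A' j = A \<inter> {\<beta>\<in>space (PiM {1..<n} (\<lambda>_. borel)). 1 / real (Suc j) \<le> T n \<beta>}"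
      using sets.sets_into_space[OF A] by (auto simp: A'_def)
    also have "\<dots> \<in> sets (PiM {1..<n} (\<lambda>_. borel))"
      by measurable
    finally show ?thesis .
  qed
  have A'_inc: "A' j \<subseteq> A' (Suc j)" for j
  proof
    fix \<beta> assume "\<beta> \<in> A' j"
    moreover have "1 / real (Suc (Suc j)) \<le> 1 / real (Suc j)"
      by (intro divide_left_mono) auto
    ultimately show "\<beta> \<in> A' (Suc j)"
      unfolding A'_def by auto
  qed
  have A'_lim: "\<forall>\<^sub>F j in sequentially. \<beta> \<in> A' j \<longleftrightarrow> \<beta> \<in> A" if "\<beta> \<in> space (PiM {1..<n} (\<lambda>_. borel))" for \<beta>
  proof -
    have "0 < T n \<beta>"
      using T n that by (simp add: time_functions_def)
    then obtain k where k: "inverse (real (Suc k)) < T n \<beta>"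
      using reals_Archimedean by blast
    have "1 / real (Suc j) \<le> T n \<beta>" if "k \<le> j" for j
    proof -
      have "1 / real (Suc j) \<le> 1 / real (Suc k)"
        using that by (intro divide_left_mono) auto
      then show ?thesis
        using k by (simp add: inverse_eq_divide)
    qed
    then show ?thesis
      by (auto simp: A'_def eventually_sequentially)
  qed
  have past [measurable]: "past \<in> path_space \<rightarrow>\<^sub>M PiM {1..<n} (\<lambda>_. borel)"
    unfolding past_def by (rule measurable_sample_restrict[OF T]) simp
  have [measurable]: "sample_time T n \<in> borel_measurable path_space"
    by (rule measurable_sample_time[OF T n])
  have [measurable]: "sample T n \<in> borel_measurable path_space"
    by (rule measurable_sample[OF T n])
  have [measurable]: "path_from B c 0 \<in> M \<rightarrow>\<^sub>M path_space" for c
    by simp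
  \<comment> \<open>The weight \<open>R\<close> is kept general, so that the limit serves the left
    side with weight \<open>1\<close> and the right side with the Gaussian ratio.\<close>
  have lim: "(\<lambda>j. \<integral>\<^sup>+\<omega>. indicator (A' j) (past (path_from B c 0 \<omega>)) *
      ennreal (g j (sample T n (path_from B c 0 \<omega>)) * R \<omega>) \<partial>M) \<longlonglongrightarrow>
      (\<integral>\<^sup>+\<omega>. indicator A (past (path_from B c 0 \<omega>)) * indicator U (sample T n (path_from B c 0 \<omega>)) *
        ennreal (R \<omega>) \<partial>M)"
    if R [measurable]: "R \<in> borel_measurable M" and R_nonneg: "\<And>\<omega>. 0 \<le> R \<omega>" for c R
  proof (rule nn_integral_LIMSEQ)
    show "incseq (\<lambda>j \<omega>. indicator (A' j) (past (path_from B c 0 \<omega>)) *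
        ennreal (g j (sample T n (path_from B c 0 \<omega>)) * R \<omega>))"
    proof (rule incseq_SucI, rule le_funI)
      fix j \<omega>
      have "g j y \<le> g (Suc j) y" for y
        using g_inc by (rule incseq_SucD)
      then show "indicator (A' j) (past (path_from B c 0 \<omega>)) *
          ennreal (g j (sample T n (path_from B c 0 \<omega>)) * R \<omega>) \<le>
          indicator (A' (Suc j)) (past (path_from B c 0 \<omega>)) *
          ennreal (g (Suc j) (sample T n (path_from B c 0 \<omega>)) * R \<omega>)"
        using A'_inc[of j] R_nonneg
        by (intro mult_mono ennreal_leI mult_right_mono) (auto split: split_indicator)
    qed
    show "(\<lambda>\<omega>. indicator (A' j) (past (path_from B c 0 \<omega>)) *
        ennreal (g j (sample T n (path_from B c 0 \<omega>)) * R \<omega>)) \<in> borel_measurable M" for j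
      by measurable
    fix \<omega>
    let ?w = "path_from B c 0 \<omega>"
    have "past ?w \<in> space (PiM {1..<n} (\<lambda>_. borel))"
      using measurable_space[OF past] by (simp add: space_PiM)
    from A'_lim[OF this] g_lim[of "sample T n ?w"]
    have "\<forall>\<^sub>F j in sequentially. indicator (A' j) (past ?w) * ennreal (g j (sample T n ?w) * R \<omega>) =
        indicator A (past ?w) * indicator U (sample T n ?w) * ennreal (R \<omega>)"
      by eventually_elim (auto split: split_indicator)
    then show "(\<lambda>j. indicator (A' j) (past ?w) * ennreal (g j (sample T n ?w) * R \<omega>)) \<longlonglongrightarrow>
        indicator A (past ?w) * indicator U (sample T n ?w) * ennreal (R \<omega>)"
      by (rule tendsto_eventually)
  qed
  have eq: "(\<integral>\<^sup>+\<omega>. indicator (A' j) (past (path_from B a 0 \<omega>)) *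
      ennreal (g j (sample T n (path_from B a 0 \<omega>)) * 1) \<partial>M) =
    (\<integral>\<^sup>+\<omega>. indicator (A' j) (past (path_from B a' 0 \<omega>)) * ennreal (g j (sample T n (path_from B a' 0 \<omega>)) *
      gaussian_ratio a a' (sample_time T n (path_from B a' 0 \<omega>)) (sample T n (path_from B a' 0 \<omega>))) \<partial>M)" for j
    using nn_integral_sample_change_origin_cont[OF T n _ A'_meas, of "1 / real (Suc j)" j "g j" "real j" a a',
      OF _ _ g_cont g g_supp]
    by (simp add: past_def A'_def)
  have [measurable]: "(\<lambda>\<omega>. gaussian_ratio a a' (sample_time T n (path_from B a' 0 \<omega>))
      (sample T n (path_from B a' 0 \<omega>))) \<in> borel_measurable M"
    unfolding gaussian_ratio_def by measurable
  show ?thesis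
    using LIMSEQ_unique[OF lim[of "\<lambda>_. 1" a, unfolded eq] lim[of "\<lambda>\<omega>. gaussian_ratio a a'
      (sample_time T n (path_from B a' 0 \<omega>)) (sample T n (path_from B a' 0 \<omega>))" a']]
    by (simp add: less_imp_le[OF gaussian_ratio_pos])
qed

text \<open>Products of a measurable set for the past and an open set for the last output form an
  intersection-stable generator on which the two laws agree by the previous lemma. Being finite they
  agree as measures, which extends the identity to all \<open>H\<close>.\<close>

lemma nn_integral_sample_change_origin:
  assumes T: "time_functions T" and n: "1 \<le> n"
    and H [measurable]: "H \<in> borel_measurable (PiM {1..n} (\<lambda>_. borel))"
  shows "(\<integral>\<^sup>+\<omega>. H (\<lambda>i\<in>{1..n}. sample T i (path_from B a 0 \<omega>)) \<partial>M) =
    (\<integral>\<^sup>+\<omega>. H (\<lambda>i\<in>{1..n}. sample T i (path_from B a' 0 \<omega>)) *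
      ennreal (gaussian_ratio a a' (sample_time T n (path_from B a' 0 \<omega>)) (sample T n (path_from B a' 0 \<omega>))) \<partial>M)"
proof -
  define P where "P = PiM {1..<n} (\<lambda>_. borel :: 'v measure)"
  let ?Q = "P \<Otimes>\<^sub>M (borel :: 'v measure)"
  define past where "past w = (\<lambda>i\<in>{1..<n}. sample T i w)" for w
  have past [measurable]: "past \<in> path_space \<rightarrow>\<^sub>M P"
    unfolding past_def P_def by (rule measurable_sample_restrict[OF T]) simp
  have [measurable]: "sample T n \<in> borel_measurable path_space"
    by (rule measurable_sample[OF T n])
  have [measurable]: "path_from B c 0 \<in> M \<rightarrow>\<^sub>M path_space" for c
    by simp
  have Tn [measurable]: "T n \<in> borel_measurable P"
    using T n unfolding time_functions_def P_def by blast
  have time: "sample_time T n w = T n (past w)" for w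
    by (simp add: sample_time_eq past_def)
  \<comment> \<open>The time is a function of the past, so the weight is a function of the pair of
    past and last output.\<close>
  define R where "R z = ennreal (gaussian_ratio a a' (T n (fst z)) (snd z))" for z
  have R [measurable]: "R \<in> borel_measurable ?Q"
    unfolding R_def gaussian_ratio_def by measurable
  define X where "X c \<omega> = (past (path_from B c 0 \<omega>), sample T n (path_from B c 0 \<omega>))" for c \<omega>
  have X [measurable]: "X c \<in> M \<rightarrow>\<^sub>M ?Q" for c
    unfolding X_def by measurable
  let ?E = "{C \<times> U | C U. C \<in> sets P \<and> U \<in> {U :: 'v set. open U}}"
  have "distr M ?Q (X a) = density (distr M ?Q (X a')) R"
  proof (rule measure_eqI_generator_eq)
    have gen: "sets ?Q = sets (sigma (space P \<times> space borel) ?E)"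
    proof (rule sets_pair_eq)
      show "sets P = sigma_sets (space P) (sets P)"
        by (simp add: sets.sigma_sets_eq)
      show "sets (borel :: 'v measure) = sigma_sets (space borel) {U. open U}"
        by (simp add: borel_def)
      show "{space P} \<subseteq> sets P" "{UNIV} \<subseteq> {U :: 'v set. open U}"
        by auto
    qed (use sets.sets_into_space[of _ P] in auto)
    have sub: "?E \<subseteq> Pow (space P \<times> space borel)"
      using sets.sets_into_space[of _ P] by auto
    show "?E \<subseteq> Pow (space P \<times> space borel)"
      by (rule sub)
    show "sets (distr M ?Q (X a)) = sigma_sets (space P \<times> space borel) ?E"
      "sets (density (distr M ?Q (X a')) R) = sigma_sets (space P \<times> space borel) ?E"
      using gen unfolding sets_measure_of[OF sub] by (simp_all only: sets_distr sets_density)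
    show "Int_stable ?E"
    proof (rule Int_stableI)
      fix X Y assume "X \<in> ?E" "Y \<in> ?E"
      then obtain C C' :: "(nat \<Rightarrow> 'v) set" and U U' :: "'v set" where XY: "X = C \<times> U" "Y = C' \<times> U'"
        and CU: "C \<in> sets P" "C' \<in> sets P" "open U" "open U'"
        by blast
      have "C \<inter> C' \<in> sets P" "open (U \<inter> U')"
        using CU by auto
      moreover have "X \<inter> Y = (C \<inter> C') \<times> (U \<inter> U')"
        unfolding XY by auto
      ultimately show "X \<inter> Y \<in> ?E"
        by blast
    qed
    show "range (\<lambda>i::nat. space P \<times> (UNIV :: 'v set)) \<subseteq> ?E"
      by auto
    show "(\<Union>i::nat. space P \<times> (UNIV :: 'v set)) = space P \<times> space borel"
      by auto
    show "emeasure (distr M ?Q (X a)) (space P \<times> UNIV) \<noteq> \<infinity>" for i :: nat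
    proof -
      interpret D: prob_space "distr M ?Q (X a)"
        by (rule prob_space_distr) (rule X)
      show ?thesis
        by simp
    qed
    fix Y assume "Y \<in> ?E"
    then obtain C U where Y: "Y = C \<times> U" and C [measurable]: "C \<in> sets P" and U: "open U"
      by auto
    have [measurable]: "U \<in> sets borel"
      using U by simp
    have "emeasure (distr M ?Q (X a)) Y = (\<integral>\<^sup>+\<omega>. indicator Y (X a \<omega>) \<partial>M)"
      unfolding Y by (subst nn_integral_indicator[symmetric], simp, subst nn_integral_distr) auto
    also have "\<dots> = (\<integral>\<^sup>+\<omega>. R (X a' \<omega>) * indicator Y (X a' \<omega>) \<partial>M)"
      using nn_integral_sample_change_origin_open[OF T n C[unfolded P_def] U, of a a']
      by (simp add: X_def Y indicator_times R_def time past_def mult_ac)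
    also have "\<dots> = emeasure (density (distr M ?Q (X a')) R) Y"
      unfolding Y by (subst emeasure_density, simp, simp, subst nn_integral_distr) auto
    finally show "emeasure (distr M ?Q (X a)) Y = emeasure (density (distr M ?Q (X a')) R) Y" .
  qed
  note law = this
  have ins: "insert n {1..<n} = {1..n}"
    using n by auto
  \<comment> \<open>Appending the last output to the past recovers the \<open>n\<close>-tuple, the
    argument of \<open>H\<close>.\<close>
  define G where "G z = H ((fst z)(n := snd z))" for z
  have "(\<lambda>z. (fst z)(n := snd z)) \<in> ?Q \<rightarrow>\<^sub>M PiM {1..n} (\<lambda>_. borel)"
    using measurable_add_dim[of n "{1..<n}" "\<lambda>_. borel :: 'v measure"] unfolding ins split_def P_def .
  then have [measurable]: "G \<in> borel_measurable ?Q"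
    unfolding G_def by (rule measurable_compose) (rule H)
  have G_X: "H (\<lambda>i\<in>{1..n}. sample T i (path_from B c 0 \<omega>)) = G (X c \<omega>)" for c \<omega>
    unfolding G_def X_def past_def using n
    by (intro arg_cong[where f=H]) (auto simp: fun_eq_iff)
  have "(\<integral>\<^sup>+\<omega>. G (X a \<omega>) \<partial>M) = (\<integral>\<^sup>+z. G z \<partial>distr M ?Q (X a))"
    by (subst nn_integral_distr) auto
  also have "\<dots> = (\<integral>\<^sup>+\<omega>. R (X a' \<omega>) * G (X a' \<omega>) \<partial>M)"
    unfolding law by (subst nn_integral_density, simp, simp, subst nn_integral_distr) auto
  finally show ?thesis
    unfolding G_X by (simp add: R_def X_def time mult_ac)
qed

end

subsection \<open>The stopped sequence and its privacy loss\<close>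

lemma tuple_space_generator:
  "{{n} \<times> C | n C. 1 \<le> n \<and> C \<in> sets (PiM {1..n} (\<lambda>_. borel :: 'v::euclidean_space measure))} \<subseteq>
    Pow (SIGMA n:{1..}. space (PiM {1..n} (\<lambda>_. borel)))"
  by (fastforce dest: sets.sets_into_space)

lemma space_tuple_space:
  "space (tuple_space :: (nat \<times> (nat \<Rightarrow> 'v::euclidean_space)) measure) =
    (SIGMA n:{1..}. space (PiM {1..n} (\<lambda>_. borel)))"
  unfolding tuple_space_def by (rule space_measure_of[OF tuple_space_generator])

lemma sets_tuple_space:
  "sets (tuple_space :: (nat \<times> (nat \<Rightarrow> 'v::euclidean_space)) measure) =
    sigma_sets (SIGMA n:{1..}. space (PiM {1..n} (\<lambda>_. borel)))
      {{n} \<times> C | n C. 1 \<le> n \<and> C \<in> sets (PiM {1..n} (\<lambda>_. borel))}"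
  unfolding tuple_space_def by (rule sets_measure_of[OF tuple_space_generator])

lemma measurable_Pair_tuple_space:
  assumes "1 \<le> n"
  shows "Pair n \<in> PiM {1..n} (\<lambda>_. borel :: 'v::euclidean_space measure) \<rightarrow>\<^sub>M tuple_space"
proof (rule measurable_sigma_sets[OF sets_tuple_space tuple_space_generator])
  show "Pair n \<in> space (PiM {1..n} (\<lambda>_. borel :: 'v measure)) \<rightarrow>
      (SIGMA n:{1..}. space (PiM {1..n} (\<lambda>_. borel)))"
    using assms by auto
  fix Y :: "(nat \<times> (nat \<Rightarrow> 'v)) set"
  assume "Y \<in> {{n} \<times> C | n C. 1 \<le> n \<and> C \<in> sets (PiM {1..n} (\<lambda>_. borel))}"
  then obtain m C where Y: "Y = {m} \<times> C" and C: "C \<in> sets (PiM {1..m} (\<lambda>_. borel :: 'v measure))"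
    by blast
  show "Pair n -` Y \<inter> space (PiM {1..n} (\<lambda>_. borel)) \<in> sets (PiM {1..n} (\<lambda>_. borel :: 'v measure))"
  proof (cases "m = n")
    case True
    then have "Pair n -` Y \<inter> space (PiM {1..n} (\<lambda>_. borel)) = C"
      using sets.sets_into_space[OF C] by (auto simp: Y)
    then show ?thesis
      using C True by simp
  next
    case False
    then have "Pair n -` Y \<inter> space (PiM {1..n} (\<lambda>_. borel)) = {}"
      by (auto simp: Y)
    then show ?thesis
      by simp
  qed
qed

text \<open>A preimage is the countable union of its slices over the lengths, and each slice belongs
  to the generator.\<close>

lemma measurable_tuple_spaceI:
  fixes f :: "nat \<times> (nat \<Rightarrow> 'v::euclidean_space) \<Rightarrow> 'b"
  assumes f: "\<And>n. 1 \<le> n \<Longrightarrow> (\<lambda>\<beta>. f (n, \<beta>)) \<in> PiM {1..n} (\<lambda>_. borel) \<rightarrow>\<^sub>M N"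
  shows "f \<in> tuple_space \<rightarrow>\<^sub>M N"
proof (rule measurableI)
  fix z :: "nat \<times> (nat \<Rightarrow> 'v)" assume "z \<in> space tuple_space"
  then show "f z \<in> space N"
    using measurable_space[OF f] unfolding space_tuple_space by blast
next
  fix A assume A: "A \<in> sets N"
  let ?S = "\<lambda>n. {n} \<times> ((\<lambda>\<beta>. f (n, \<beta>)) -` A \<inter> space (PiM {1..n} (\<lambda>_. borel)))"
  have "?S n \<in> sets tuple_space" if "n \<in> {1..}" for n
    unfolding sets_tuple_space
    using that measurable_sets[OF f A] by (intro sigma_sets.Basic) auto
  then have "(\<Union>n\<in>{1..}. ?S n) \<in> sets tuple_space"
    by (intro sets.countable_UN) auto
  moreover have "f -` A \<inter> space tuple_space = (\<Union>n\<in>{1..}. ?S n)"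
    unfolding space_tuple_space by auto
  ultimately show "f -` A \<inter> space tuple_space \<in> sets tuple_space"
    by simp
qed

section \<open>From a density to the privacy loss\<close>

lemma ln_ennreal_ennreal:
  assumes "0 < r"
  shows "ln_ennreal (ennreal r) = ereal (ln r)"
  using assms by (simp add: ln_ennreal_def)

text \<open>Uniqueness of densities turns the identity of laws into \<open>p = p' * r\<close> almost
  everywhere, for whichever reference measure and densities the loss was formed with.\<close>

lemma (in prob_space) privacy_loss_density:
  fixes r :: "'b \<Rightarrow> real"
  assumes A [measurable]: "A \<in> M \<rightarrow>\<^sub>M S"
    and r [measurable]: "r \<in> borel_measurable S" and r_pos: "\<And>z. 0 < r z"
    and law: "distr M S A = density (distr M S A') (\<lambda>z. ennreal (r z))"
    and L: "is_privacy_loss M S A A' L"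
  shows "AE \<omega> in M. L \<omega> = ereal (ln (r (A \<omega>)))"
proof -
  obtain \<mu> p p' where sets [measurable_cong]: "sets \<mu> = sets S"
    and p [measurable]: "p \<in> borel_measurable \<mu>" and p' [measurable]: "p' \<in> borel_measurable \<mu>"
    and dA: "distr M S A = density \<mu> p" and dA': "distr M S A' = density \<mu> p'"
    and L_eq: "AE \<omega> in M. L \<omega> = ln_ennreal (p (A \<omega>) / p' (A \<omega>))"
    using L unfolding is_privacy_loss_def by blast
  interpret D: prob_space "density \<mu> p"
    unfolding dA[symmetric] by (rule prob_space_distr) simp
  have "(\<integral>\<^sup>+z. p z \<partial>\<mu>) = 1"
    using D.emeasure_space_1 by (simp add: emeasure_density)
  then have fin: "(\<integral>\<^sup>+z. p z \<partial>\<mu>) \<noteq> \<infinity>"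
    by simp
  have "density \<mu> p = density \<mu> (\<lambda>z. p' z * ennreal (r z))"
    using law unfolding dA dA' by (simp add: density_density_eq)
  then have "AE z in \<mu>. p z = p' z * ennreal (r z)"
    using fin by (subst (asm) finite_density_unique) auto
  moreover have "AE z in \<mu>. p z \<noteq> \<infinity>"
    using fin by (intro nn_integral_PInf_AE) auto
  ultimately have "AE z in \<mu>. 0 < p z \<longrightarrow> ln_ennreal (p z / p' z) = ereal (ln (r z))"
  proof eventually_elim
    case (elim z)
    show ?case
    proof
      \<comment> \<open>Positivity and finiteness of \<open>p z\<close> exclude \<open>0\<close> and
        \<open>\<top>\<close> for \<open>p' z\<close>, so the quotient of extended reals
        cancels.\<close>
      assume pos: "0 < p z"
      with elim have "p' z \<noteq> 0"
        by auto
      moreover have "p' z \<noteq> \<top>"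
        using elim r_pos[of z] by (auto simp: ennreal_top_mult)
      ultimately have "p z / p' z = ennreal (r z)"
        unfolding elim(1) by (subst mult.commute) (rule ennreal_mult_divide_eq)
      then show "ln_ennreal (p z / p' z) = ereal (ln (r z))"
        by (simp add: ln_ennreal_ennreal r_pos)
    qed
  qed
  \<comment> \<open>The law of \<open>A\<close> has density \<open>p\<close>, so the points with
    \<open>p z = 0\<close> are null for it and the restriction disappears.\<close>
  then have "AE z in distr M S A. ln_ennreal (p z / p' z) = ereal (ln (r z))"
    unfolding dA by (simp add: AE_density)
  then have "AE \<omega> in M. ln_ennreal (p (A \<omega>) / p' (A \<omega>)) = ereal (ln (r (A \<omega>)))"
    by (rule AE_distrD[OF A])
  with L_eq show ?thesis
    by eventually_elim simp
qed

section \<open>Law of the stopped sequence\<close>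

context brownian_motion
begin

lemma measurable_BM:
  assumes T: "time_functions T" and "1 \<le> i"
  shows "BM f T B y i \<in> borel_measurable M"
proof -
  have "(\<lambda>\<omega>. sample T i (path_from B (f y) 0 \<omega>)) \<in> borel_measurable M"
    by (rule measurable_compose[OF measurable_path_from measurable_sample[OF assms]]) simp
  then show ?thesis
    by (rule measurable_cong[THEN iffD1, rotated]) (simp add: BM_eq_sample[OF assms(1) _ assms(2)])
qed

text \<open>Stopping exactly at \<open>n\<close> means stopping by \<open>n\<close> but not by
  \<open>n - 1\<close>, hence a region for the first \<open>n\<close> outputs. That the region is
  common to all databases is what makes their laws comparable.\<close>

lemma stopping_regions:
  assumes T: "time_functions T" and N: "stopping_function M X f T B N"
  obtains E where "\<And>n. 1 \<le> n \<Longrightarrow> E n \<in> sets (PiM {1..n} (\<lambda>_. borel))"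
    "\<And>n y \<omega>. 1 \<le> n \<Longrightarrow> y \<in> X \<Longrightarrow> \<omega> \<in> space M \<Longrightarrow>
      stop_index f T B N y \<omega> = n \<longleftrightarrow> (\<lambda>i\<in>{1..n}. BM f T B y i \<omega>) \<in> E n"
proof -
  obtain C where C: "\<And>n. 1 \<le> n \<Longrightarrow> C n \<in> sets (PiM {1..n} (\<lambda>_. borel))"
    and stop: "\<And>n y \<omega>. 1 \<le> n \<Longrightarrow> y \<in> X \<Longrightarrow> \<omega> \<in> space M \<Longrightarrow>
      stop_index f T B N y \<omega> \<le> n \<longleftrightarrow> (\<lambda>i\<in>{1..n}. BM f T B y i \<omega>) \<in> C n"
    using N unfolding stopping_function_def by metis
  \<comment> \<open>For \<open>n = 1\<close> nothing is subtracted: index \<open>0\<close> has no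
    region, and stopping never occurs before \<open>1\<close>.\<close>
  define E where "E n = (if n = 1 then C n else
    C n - ((\<lambda>\<beta>. restrict \<beta> {1..n - 1}) -` C (n - 1) \<inter> space (PiM {1..n} (\<lambda>_. borel))))" for n
  show ?thesis
  proof (rule that)
    fix n :: nat assume n: "1 \<le> n"
    have "(\<lambda>\<beta>. restrict \<beta> {1..n - 1}) \<in> PiM {1..n} (\<lambda>_. borel :: 'v measure) \<rightarrow>\<^sub>M PiM {1..n - 1} (\<lambda>_. borel)"
      by (rule measurable_restrict_subset) auto
    then show "E n \<in> sets (PiM {1..n} (\<lambda>_. borel))"
      unfolding E_def using C[OF n] C[of "n - 1"] n by (auto intro!: sets.Diff measurable_sets simp del: One_nat_def)
    fix y \<omega> assume y: "y \<in> X" "\<omega> \<in> space M"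
    have ge: "1 \<le> stop_index f T B N y \<omega>"
      using N by (simp add: stopping_function_def stop_index_def space_PiM)
    show "stop_index f T B N y \<omega> = n \<longleftrightarrow> (\<lambda>i\<in>{1..n}. BM f T B y i \<omega>) \<in> E n"
    proof (cases "n = 1")
      case True
      then show ?thesis
        using stop[OF n y] ge by (auto simp: E_def)
    next
      case False
      then have n': "1 \<le> n - 1"
        using n by simp
      have res: "restrict (\<lambda>i\<in>{1..n}. BM f T B y i \<omega>) {1..n - 1} = (\<lambda>i\<in>{1..n - 1}. BM f T B y i \<omega>)"
        by (auto simp: fun_eq_iff)
      have "(\<lambda>i\<in>{1..n}. BM f T B y i \<omega>) \<in> E n \<longleftrightarrow>
          stop_index f T B N y \<omega> \<le> n \<and> \<not> stop_index f T B N y \<omega> \<le> n - 1"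
        unfolding stop[OF n y] stop[OF n' y] E_def using False
        by (simp add: res space_PiM del: One_nat_def restrict_restrict)
      then show ?thesis
        using n by auto
    qed
  qed
qed

text \<open>The Gaussian ratio at the last entry of a tuple, its time being recomputed from the
  earlier entries; as a function of the tuple alone it can serve as a density on
  \<open>tuple_space\<close>.\<close>

definition tuple_ratio :: "(nat \<Rightarrow> (nat \<Rightarrow> 'v) \<Rightarrow> real) \<Rightarrow> 'v \<Rightarrow> 'v \<Rightarrow> nat \<times> (nat \<Rightarrow> 'v) \<Rightarrow> real" where
  "tuple_ratio T a a' = (\<lambda>(n, \<beta>). gaussian_ratio a a' (T n (restrict \<beta> {1..<n})) (\<beta> n))"

lemma measurable_tuple_ratio:
  assumes T: "time_functions T"
  shows "tuple_ratio T a a' \<in> borel_measurable tuple_space"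
proof (rule measurable_tuple_spaceI)
  fix n :: nat assume n: "1 \<le> n"
  have "(\<lambda>\<beta>. restrict \<beta> {1..<n}) \<in> PiM {1..n} (\<lambda>_. borel :: 'v measure) \<rightarrow>\<^sub>M PiM {1..<n} (\<lambda>_. borel)"
    by (rule measurable_restrict_subset) auto
  moreover have "T n \<in> borel_measurable (PiM {1..<n} (\<lambda>_. borel))"
    using T n by (simp add: time_functions_def)
  ultimately have [measurable]: "(\<lambda>\<beta>. T n (restrict \<beta> {1..<n})) \<in> borel_measurable (PiM {1..n} (\<lambda>_. borel))"
    by (rule measurable_compose)
  have [measurable]: "(\<lambda>\<beta>. \<beta> n) \<in> borel_measurable (PiM {1..n} (\<lambda>_. borel :: 'v measure))"
    using n by (intro measurable_component_singleton) simp
  show "(\<lambda>\<beta>. tuple_ratio T a a' (n, \<beta>)) \<in> borel_measurable (PiM {1..n} (\<lambda>_. borel))"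
    unfolding tuple_ratio_def gaussian_ratio_def prod.case by measurable
qed

lemma measurable_stopped_BM:
  assumes T: "time_functions T" and N: "stopping_function M X f T B N" and y: "y \<in> X"
  shows "stopped_BM f T B N y \<in> M \<rightarrow>\<^sub>M tuple_space"
proof -
  obtain E where E: "\<And>n. 1 \<le> n \<Longrightarrow> E n \<in> sets (PiM {1..n} (\<lambda>_. borel))"
    and stop: "\<And>n y \<omega>. 1 \<le> n \<Longrightarrow> y \<in> X \<Longrightarrow> \<omega> \<in> space M \<Longrightarrow>
      stop_index f T B N y \<omega> = n \<longleftrightarrow> (\<lambda>i\<in>{1..n}. BM f T B y i \<omega>) \<in> E n"
    using stopping_regions[OF T N] by metis
  have tuple: "(\<lambda>\<omega>. \<lambda>i\<in>{1..n}. BM f T B y i \<omega>) \<in> M \<rightarrow>\<^sub>M PiM {1..n} (\<lambda>_. borel)" for n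
    by (intro measurable_restrict measurable_BM[OF T]) simp
  have "stop_index f T B N y -` {n} \<inter> space M \<in> sets M" if "1 \<le> n" for n
  proof -
    have "stop_index f T B N y -` {n} \<inter> space M = (\<lambda>\<omega>. \<lambda>i\<in>{1..n}. BM f T B y i \<omega>) -` E n \<inter> space M"
      using stop[OF that y] by auto
    then show ?thesis
      using measurable_sets[OF tuple E[OF that]] by simp
  qed
  moreover have "1 \<le> stop_index f T B N y \<omega>" for \<omega>
    using N by (simp add: stopping_function_def stop_index_def space_PiM)
  ultimately have "stop_index f T B N y \<in> M \<rightarrow>\<^sub>M count_space {1..}"
    by (subst measurable_count_space_eq_countable) auto
  moreover have "(\<lambda>\<omega>. (n, \<lambda>i\<in>{1..n}. BM f T B y i \<omega>)) \<in> M \<rightarrow>\<^sub>M tuple_space" if "n \<in> {1..}" for n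
    using measurable_compose[OF tuple measurable_Pair_tuple_space] that by simp
  ultimately show ?thesis
    unfolding stopped_BM_def[abs_def]
    by (intro measurable_compose_countable'[where I="{1..}" and g="stop_index f T B N y"
          and f="\<lambda>n \<omega>. (n, \<lambda>i\<in>{1..n}. BM f T B y i \<omega>)"]) auto
qed

text \<open>The output is split according to its length. For each length the change of origin for
  finitely many outputs applies, with the stopping region as part of the test function, and the
  weight is \<open>tuple_ratio\<close> of the stopped sequence.\<close>

lemma distr_stopped_BM_change_origin:
  assumes T: "time_functions T" and N: "stopping_function M X f T B N"
    and x: "x \<in> X" and x': "x' \<in> X"
  shows "distr M tuple_space (stopped_BM f T B N x) =
    density (distr M tuple_space (stopped_BM f T B N x'))
      (\<lambda>z. ennreal (tuple_ratio T (f x) (f x') z))"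
proof (rule measure_eqI)
  fix S assume "S \<in> sets (distr M tuple_space (stopped_BM f T B N x))"
  then have S [measurable]: "S \<in> sets tuple_space"
    by simp
  obtain E where E: "\<And>n. 1 \<le> n \<Longrightarrow> E n \<in> sets (PiM {1..n} (\<lambda>_. borel))"
    and stop: "\<And>n y \<omega>. 1 \<le> n \<Longrightarrow> y \<in> X \<Longrightarrow> \<omega> \<in> space M \<Longrightarrow>
      stop_index f T B N y \<omega> = n \<longleftrightarrow> (\<lambda>i\<in>{1..n}. BM f T B y i \<omega>) \<in> E n"
    using stopping_regions[OF T N] by metis
  let ?R = "\<lambda>z. ennreal (tuple_ratio T (f x) (f x') z)"
  have R [measurable]: "?R \<in> borel_measurable tuple_space"
    using measurable_tuple_ratio[OF T] by simp
  note [measurable] = measurable_stopped_BM[OF T N x] measurable_stopped_BM[OF T N x']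
  define path where "path y \<omega> = path_from B (f y) 0 \<omega>" for y \<omega>
  \<comment> \<open>The series run over \<open>m\<close> from \<open>0\<close>, so \<open>m\<close>
    stands for the length \<open>Suc m\<close>.\<close>
  define H where "H m \<beta> = (indicator (E (Suc m)) \<beta> * indicator S (Suc m, \<beta>) :: ennreal)" for m \<beta>
  have H: "H m \<in> borel_measurable (PiM {1..Suc m} (\<lambda>_. borel))" for m
  proof -
    have [measurable]: "E (Suc m) \<in> sets (PiM {1..Suc m} (\<lambda>_. borel))"
      by (rule E) simp
    have [measurable]: "Pair (Suc m) \<in> PiM {1..Suc m} (\<lambda>_. borel :: 'v measure) \<rightarrow>\<^sub>M tuple_space"
      by (rule measurable_Pair_tuple_space) simp
    show ?thesis
      unfolding H_def by measurable
  qed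
  have tuple: "(\<lambda>\<omega>. \<lambda>i\<in>{1..n}. sample T i (path y \<omega>)) \<in> M \<rightarrow>\<^sub>M PiM {1..n} (\<lambda>_. borel)" for n y
    unfolding path_def
    by (rule measurable_compose[OF measurable_path_from measurable_sample_restrict[OF T]]) auto
  have [measurable]: "(\<lambda>\<omega>. H m (\<lambda>i\<in>{1..Suc m}. sample T i (path x' \<omega>))) \<in> borel_measurable M" for m
    by (rule measurable_compose[OF tuple H])
  \<comment> \<open>For each outcome at most one term survives, the one with \<open>Suc m\<close>
    equal to the stopping index.\<close>
  have HS: "H m (\<lambda>i\<in>{1..Suc m}. sample T i (path y \<omega>)) =
      (if m = stop_index f T B N y \<omega> - 1 then indicator S (stopped_BM f T B N y \<omega>) else 0)"
    if y: "y \<in> X" and \<omega>: "\<omega> \<in> space M" for m y \<omega>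
  proof -
    have "(\<lambda>i\<in>{1..Suc m}. sample T i (path y \<omega>)) = (\<lambda>i\<in>{1..Suc m}. BM f T B y i \<omega>)"
      unfolding path_def by (rule restrict_ext) (simp add: BM_eq_sample[OF T \<omega>])
    moreover have "1 \<le> stop_index f T B N y \<omega>"
      using N by (simp add: stopping_function_def stop_index_def space_PiM)
    then have "stop_index f T B N y \<omega> = Suc m \<longleftrightarrow> m = stop_index f T B N y \<omega> - 1"
      by auto
    ultimately show ?thesis
      using stop[of "Suc m", OF _ y \<omega>] by (auto simp: H_def stopped_BM_def indicator_def)
  qed
  have sum_single: "(\<Sum>m. if m = k then c else (0::ennreal)) = c" for k :: nat and c
    using sums_unique[OF sums_single[of k "\<lambda>_. c"]] by simp
  have ratio: "tuple_ratio T (f x) (f x') (stopped_BM f T B N x' \<omega>) =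
      gaussian_ratio (f x) (f x') (sample_time T (Suc m) (path x' \<omega>)) (sample T (Suc m) (path x' \<omega>))"
    if \<omega>: "\<omega> \<in> space M" and m: "m = stop_index f T B N x' \<omega> - 1" for \<omega> m
  proof -
    have "1 \<le> stop_index f T B N x' \<omega>"
      using N by (simp add: stopping_function_def stop_index_def space_PiM)
    then have k: "stop_index f T B N x' \<omega> = Suc m"
      using m by simp
    have "restrict (\<lambda>i\<in>{1..Suc m}. BM f T B x' i \<omega>) {1..<Suc m} =
        (\<lambda>i\<in>{1..<Suc m}. sample T i (path x' \<omega>))"
      unfolding path_def by (auto simp: fun_eq_iff BM_eq_sample[OF T \<omega>])
    then show ?thesis
      unfolding tuple_ratio_def stopped_BM_def k
      by (simp add: sample_time_eq path_def BM_eq_sample[OF T \<omega>] del: One_nat_def restrict_restrict)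
  qed
  have "emeasure (distr M tuple_space (stopped_BM f T B N x)) S =
      (\<integral>\<^sup>+\<omega>. indicator S (stopped_BM f T B N x \<omega>) \<partial>M)"
    by (subst nn_integral_indicator[symmetric], simp, subst nn_integral_distr) auto
  also have "\<dots> = (\<integral>\<^sup>+\<omega>. (\<Sum>m. H m (\<lambda>i\<in>{1..Suc m}. sample T i (path x \<omega>))) \<partial>M)"
    by (intro nn_integral_cong) (simp only: HS[OF x] sum_single)
  also have "\<dots> = (\<Sum>m. \<integral>\<^sup>+\<omega>. H m (\<lambda>i\<in>{1..Suc m}. sample T i (path x \<omega>)) \<partial>M)"
    by (intro nn_integral_suminf measurable_compose[OF tuple H])
  also have "\<dots> = (\<Sum>m. \<integral>\<^sup>+\<omega>. H m (\<lambda>i\<in>{1..Suc m}. sample T i (path x' \<omega>)) *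
      ennreal (gaussian_ratio (f x) (f x') (sample_time T (Suc m) (path x' \<omega>))
        (sample T (Suc m) (path x' \<omega>))) \<partial>M)"
    unfolding path_def by (intro suminf_cong nn_integral_sample_change_origin[OF T _ H]) simp
  also have "\<dots> = (\<Sum>m. \<integral>\<^sup>+\<omega>. ?R (stopped_BM f T B N x' \<omega>) * H m (\<lambda>i\<in>{1..Suc m}. sample T i (path x' \<omega>)) \<partial>M)"
  proof (intro suminf_cong nn_integral_cong)
    fix m \<omega> assume \<omega>: "\<omega> \<in> space M"
    show "H m (\<lambda>i\<in>{1..Suc m}. sample T i (path x' \<omega>)) *
        ennreal (gaussian_ratio (f x) (f x') (sample_time T (Suc m) (path x' \<omega>))
          (sample T (Suc m) (path x' \<omega>))) =
        ?R (stopped_BM f T B N x' \<omega>) * H m (\<lambda>i\<in>{1..Suc m}. sample T i (path x' \<omega>))"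
    \<comment> \<open>Off the event that the length is \<open>Suc m\<close> the two weights may
      differ, but there \<open>H m\<close> vanishes.\<close>
    proof (cases "m = stop_index f T B N x' \<omega> - 1")
      case True
      show ?thesis
        unfolding ratio[OF \<omega> True] by (rule mult.commute)
    next
      case False
      then show ?thesis
        unfolding HS[OF x' \<omega>] by simp
    qed
  qed
  also have "\<dots> = (\<integral>\<^sup>+\<omega>. (\<Sum>m. ?R (stopped_BM f T B N x' \<omega>) * H m (\<lambda>i\<in>{1..Suc m}. sample T i (path x' \<omega>))) \<partial>M)"
    by (rule nn_integral_suminf[symmetric]) measurable
  also have "\<dots> = (\<integral>\<^sup>+\<omega>. ?R (stopped_BM f T B N x' \<omega>) * indicator S (stopped_BM f T B N x' \<omega>) \<partial>M)"
    by (intro nn_integral_cong) (simp only: ennreal_suminf_cmult HS[OF x'] sum_single)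
  also have "\<dots> = emeasure (density (distr M tuple_space (stopped_BM f T B N x')) ?R) S"
    by (subst emeasure_density, simp, simp, subst nn_integral_distr) auto
  finally show "emeasure (distr M tuple_space (stopped_BM f T B N x)) S =
      emeasure (density (distr M tuple_space (stopped_BM f T B N x')) ?R) S" .
qed simp

text \<open>Expanding the squares cancels the squared norm of \<open>B \<tau> \<omega>\<close> and
  leaves a term linear in the motion, which sees only the direction of
  \<open>f x - f x'\<close>.\<close>

lemma ln_tuple_ratio_stopped_BM:
  fixes u :: 'v
  assumes T: "time_functions T" and N: "stopping_function M X f T B N" and \<omega>: "\<omega> \<in> space M"
    and u: "norm (f x - f x') *\<^sub>R u = f x - f x'"
  defines "\<tau> \<equiv> stopped_time f T B N x \<omega>"
  shows "0 < \<tau>" and "ln (tuple_ratio T (f x) (f x') (stopped_BM f T B N x \<omega>)) =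
    (norm (f x - f x'))\<^sup>2 / (2 * \<tau>) + norm (f x - f x') / \<tau> * (u \<bullet> B \<tau> \<omega>)"
proof -
  let ?n = "stop_index f T B N x \<omega>"
  have n: "1 \<le> ?n"
    using N by (simp add: stopping_function_def stop_index_def space_PiM)
  have \<tau>_eq: "\<tau> = T ?n (\<lambda>i\<in>{1..<?n}. BM f T B x i \<omega>)"
    by (simp add: \<tau>_def stopped_time_def BM_time_def)
  show "0 < \<tau>"
    using T n unfolding \<tau>_eq time_functions_def by (simp add: space_PiM)
  have "restrict (\<lambda>i\<in>{1..?n}. BM f T B x i \<omega>) {1..<?n} = (\<lambda>i\<in>{1..<?n}. BM f T B x i \<omega>)"
    by (auto simp: fun_eq_iff)
  moreover have "BM f T B x ?n \<omega> = f x + B \<tau> \<omega>"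
    by (subst BM.simps) (simp add: \<tau>_eq)
  ultimately have "tuple_ratio T (f x) (f x') (stopped_BM f T B N x \<omega>) =
      gaussian_ratio (f x) (f x') \<tau> (f x + B \<tau> \<omega>)"
    using n by (simp add: tuple_ratio_def stopped_BM_def \<tau>_eq del: One_nat_def restrict_restrict)
  moreover have "(norm (f x + B \<tau> \<omega> - f x'))\<^sup>2 - (norm (f x + B \<tau> \<omega> - f x))\<^sup>2 =
      (norm (f x - f x'))\<^sup>2 + 2 * (norm (f x - f x') * (u \<bullet> B \<tau> \<omega>))"
  proof -
    have "(norm (f x + B \<tau> \<omega> - f x'))\<^sup>2 = (norm ((f x - f x') + B \<tau> \<omega>))\<^sup>2"
      by (simp add: algebra_simps)
    also have "\<dots> = (norm (f x - f x'))\<^sup>2 + 2 * ((f x - f x') \<bullet> B \<tau> \<omega>) + (norm (B \<tau> \<omega>))\<^sup>2"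
      unfolding power2_norm_eq_inner by (simp add: inner_add_left inner_add_right inner_commute)
    also have "(f x - f x') \<bullet> B \<tau> \<omega> = norm (f x - f x') * (u \<bullet> B \<tau> \<omega>)"
      by (subst u[symmetric]) simp
    finally show ?thesis
      by simp
  qed
  ultimately show "ln (tuple_ratio T (f x) (f x') (stopped_BM f T B N x \<omega>)) =
      (norm (f x - f x'))\<^sup>2 / (2 * \<tau>) + norm (f x - f x') / \<tau> * (u \<bullet> B \<tau> \<omega>)"
    using \<open>0 < \<tau>\<close> by (simp add: gaussian_ratio_def add_divide_distrib)
qed

end

section \<open>The privacy loss of the stopped mechanism\<close>

theorem theorem3p4:
  fixes X :: "'x set" and nbr :: "'x \<Rightarrow> 'x \<Rightarrow> bool"
    and f :: "'x \<Rightarrow> real ^ 'd"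
    and T :: "nat \<Rightarrow> (nat \<Rightarrow> real ^ 'd) \<Rightarrow> real"
    and M :: "'a measure" and B :: "real \<Rightarrow> 'a \<Rightarrow> real ^ 'd"
    and N :: "(nat \<Rightarrow> real ^ 'd) \<Rightarrow> nat"
  assumes "time_functions T"
    and "standard_brownian_motion M B"
    and "stopping_function M X f T B N"
    and "x \<in> X" and "x' \<in> X" and "nbr x x'"
  shows "\<exists>W :: real \<Rightarrow> 'a \<Rightarrow> real. standard_brownian_motion M W \<and>
    (\<forall>L. is_privacy_loss M tuple_space (stopped_BM f T B N x) (stopped_BM f T B N x') L \<longrightarrow>
      (AE \<omega> in M. let \<tau> = stopped_time f T B N x \<omega> in
        L \<omega> = ereal ((norm (f x - f x'))\<^sup>2 / (2 * \<tau>) + norm (f x - f x') / \<tau> * W \<tau> \<omega>)) \<and>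
      (\<forall>\<Delta>\<^sub>2::real. l2_sensitivity X nbr f \<le> ereal \<Delta>\<^sub>2 \<longrightarrow>
        (AE \<omega> in M. let \<tau> = stopped_time f T B N x \<omega> in
          L \<omega> \<le> ereal (\<Delta>\<^sub>2\<^sup>2 / (2 * \<tau>) + \<Delta>\<^sub>2 / \<tau> * max 0 (W \<tau> \<omega>)))))"
proof -
  interpret brownian_motion M B
    by standard fact
  let ?\<delta> = "norm (f x - f x')"
  \<comment> \<open>The direction of the difference. If the difference is zero, any unit vector
    satisfies the equation, and the projection is still a standard Brownian motion.\<close>
  obtain u :: "real ^ 'd" where u: "norm u = 1" "?\<delta> *\<^sub>R u = f x - f x'"
  proof (cases "f x = f x'")
    case True
    obtain u :: "real ^ 'd" where "norm u = 1"
      using vector_choose_size[of 1] by auto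
    with True show ?thesis
      by (intro that[of u]) auto
  next
    case False
    then show ?thesis
      by (intro that[of "sgn (f x - f x')"]) (auto simp: norm_sgn sgn_div_norm)
  qed
  let ?\<tau> = "stopped_time f T B N x"
  have eq: "AE \<omega> in M. L \<omega> = ereal (?\<delta>\<^sup>2 / (2 * ?\<tau> \<omega>) + ?\<delta> / ?\<tau> \<omega> * (u \<bullet> B (?\<tau> \<omega>) \<omega>))"
    if L: "is_privacy_loss M tuple_space (stopped_BM f T B N x) (stopped_BM f T B N x') L" for L
  proof -
    have "AE \<omega> in M. L \<omega> = ereal (ln (tuple_ratio T (f x) (f x') (stopped_BM f T B N x \<omega>)))"
    proof (rule privacy_loss_density[OF _ _ _ _ L])
      show "0 < tuple_ratio T (f x) (f x') z" for z
        by (cases z) (simp add: tuple_ratio_def gaussian_ratio_pos)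
    qed (use assms in \<open>auto intro!: measurable_stopped_BM measurable_tuple_ratio distr_stopped_BM_change_origin\<close>)
    then show ?thesis
      using AE_space by eventually_elim (simp add: ln_tuple_ratio_stopped_BM(2)[OF assms(1,3) _ u(2)])
  qed
  have le: "AE \<omega> in M. L \<omega> \<le> ereal (\<Delta>\<^sup>2 / (2 * ?\<tau> \<omega>) + \<Delta> / ?\<tau> \<omega> * max 0 (u \<bullet> B (?\<tau> \<omega>) \<omega>))"
    if L: "is_privacy_loss M tuple_space (stopped_BM f T B N x) (stopped_BM f T B N x') L"
      and \<Delta>: "l2_sensitivity X nbr f \<le> ereal \<Delta>" for L \<Delta>
  proof -
    have "ereal ?\<delta> \<le> l2_sensitivity X nbr f"
      unfolding l2_sensitivity_def
      by (rule SUP_upper2[of "(x, x')"]) (use assms in auto)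
    with \<Delta> have \<delta>: "?\<delta> \<le> \<Delta>"
      using ereal_less_eq(3) order_trans by blast
    show ?thesis
      using eq[OF L] AE_space
    proof eventually_elim
      case (elim \<omega>)
      have \<tau>: "0 < ?\<tau> \<omega>"
        using ln_tuple_ratio_stopped_BM(1)[OF assms(1,3) elim(2) u(2)] .
      \<comment> \<open>The positive part comes first: only with a nonnegative factor may the
        coefficient be enlarged from \<open>?\<delta>\<close> to \<open>\<Delta>\<close>.\<close>
      have "?\<delta> / ?\<tau> \<omega> * (u \<bullet> B (?\<tau> \<omega>) \<omega>) \<le> ?\<delta> / ?\<tau> \<omega> * max 0 (u \<bullet> B (?\<tau> \<omega>) \<omega>)"
        using \<tau> by (intro mult_left_mono) auto
      also have "\<dots> \<le> \<Delta> / ?\<tau> \<omega> * max 0 (u \<bullet> B (?\<tau> \<omega>) \<omega>)"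
        using \<tau> \<delta> by (intro mult_right_mono divide_right_mono) auto
      finally have "?\<delta> / ?\<tau> \<omega> * (u \<bullet> B (?\<tau> \<omega>) \<omega>) \<le> \<Delta> / ?\<tau> \<omega> * max 0 (u \<bullet> B (?\<tau> \<omega>) \<omega>)" .
      moreover have "?\<delta>\<^sup>2 / (2 * ?\<tau> \<omega>) \<le> \<Delta>\<^sup>2 / (2 * ?\<tau> \<omega>)"
        using \<tau> \<delta> by (intro divide_right_mono power_mono) auto
      ultimately show ?case
        unfolding elim(1) by simp
    qed
  qed
  \<comment> \<open>The witness is fixed by \<open>x\<close>, \<open>x'\<close>, \<open>f\<close>
    and \<open>B\<close>, so one motion serves all versions of the loss and all sensitivity
    bounds.\<close>
  show ?thesis
    unfolding Let_def
    by (rule exI[of _ "\<lambda>t \<omega>. u \<bullet> B t \<omega>"])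
      (use standard_brownian_motion_inner[OF assms(2) u(1)] eq le in blast)
qed

end
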